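(* Let $M$ be a finite-dimensional Riemannian manifold, let $f:M\to(-\infty,+\infty]$ be a lower semicontinuous function, and let $x\in M$, $\zeta\in TM_x^*$, $A\in\mathcal{L}^2_s(TM_x,\mathbb{R})$. Then $$(\zeta,A)\in J^{2,-}f(x)\iff(\zeta,A)\in J^{2,-}(f\circ\exp_x)(0_x).$$
   Context: $\mathcal{L}^2_s(TM_x,\mathbb{R})$ is the space of symmetric bilinear forms on $TM_x$. For a lower semicontinuous function $f$ on a Riemannian manifold, $$J^{2,-}f(x)=\{(d\varphi(x),d^2\varphi(x)):\varphi\text{ is }C^2,\ f-\varphi\text{ attains a local minimum at }x\}$$ (the same set results if $\varphi$ is only required to be $C^2$ near $x$), where $d^2\varphi(x)(v,w)=\langle\nabla_X\nabla\varphi,Y\rangle(x)$ for vector fields with $X(x)=v$, $Y(x)=w$ is the Riemannian Hessian. The function $f\circ\exp_x$ is considered on a neighborhood of the origin $0_x$ in the Euclidean space $TM_x$ (with inner product given by the metric at $x$), on which $\exp_x$ is a diffeomorphism onto its image, and the tangent space of $TM_x$ at $0_x$ is identified with $TM_x$. *)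

theory Defs
  imports "HOL-Analysis.Analysis"
begin

text \<open>Functions of class \<open>C\<^sup>k\<close> between Euclidean spaces; only meant for open sets \<open>S\<close>.\<close>

fun Ck_on :: "nat \<Rightarrow> 'a::euclidean_space set \<Rightarrow> ('a \<Rightarrow> 'b::euclidean_space) \<Rightarrow> bool" where
  "Ck_on 0 S f \<longleftrightarrow> continuous_on S f"
| "Ck_on (Suc k) S f \<longleftrightarrow>
     (\<forall>x\<in>S. f differentiable (at x)) \<and>
     (\<forall>v. Ck_on k S (\<lambda>x. frechet_derivative f (at x) v))"

definition smooth_on :: "'a::euclidean_space set \<Rightarrow> ('a \<Rightarrow> 'b::euclidean_space) \<Rightarrow> bool" where
  "smooth_on S f \<longleftrightarrow> (\<forall>k. Ck_on k S f)"


text \<open>A chart is a pair (domain, coordinate map). The inverse coordinate map is meaningful on the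
  image of the domain only.\<close>

type_synonym ('m, 'e) chart = "'m set \<times> ('m \<Rightarrow> 'e)"

abbreviation chart_dom :: "('m, 'e) chart \<Rightarrow> 'm set" where "chart_dom \<equiv> fst"
abbreviation chart_map :: "('m, 'e) chart \<Rightarrow> 'm \<Rightarrow> 'e" where "chart_map \<equiv> snd"

abbreviation chart_im :: "('m, 'e) chart \<Rightarrow> 'e set" where
  "chart_im c \<equiv> chart_map c ` chart_dom c"

definition chart_inv :: "('m, 'e) chart \<Rightarrow> 'e \<Rightarrow> 'm" where
  "chart_inv c = inv_into (chart_dom c) (chart_map c)"

definition is_chart :: "('m::topological_space, 'e::euclidean_space) chart \<Rightarrow> bool" where
  "is_chart c \<longleftrightarrow> open (chart_dom c) \<and> open (chart_im c) \<and>
     homeomorphism (chart_dom c) (chart_im c) (chart_map c) (chart_inv c)"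

definition transition :: "('m, 'e) chart \<Rightarrow> ('m, 'e) chart \<Rightarrow> 'e \<Rightarrow> 'e" where
  "transition c d = chart_map d \<circ> chart_inv c"


text \<open>The tangent space at \<open>x\<close> is represented by the model space \<open>'e\<close> itself: \<open>v :: 'e\<close> stands
  for the tangent vector whose coordinates in the preferred chart \<open>chart_at M x\<close> are \<open>v\<close>. The
  preferred charts are an arbitrary part of the structure. They need not depend continuously on
  \<open>x\<close>, so vector fields have to be moved into one fixed chart before they are differentiated
  (\<open>tcoord\<close>, \<open>tvec\<close> below).

  \<open>metric M x v w\<close> is the inner product of the tangent vectors \<open>v\<close> and \<open>w\<close> at \<open>x\<close>.\<close>

record ('m, 'e) riem =
  atlas :: "('m, 'e) chart set"
  chart_at :: "'m \<Rightarrow> ('m, 'e) chart"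
  metric :: "'m \<Rightarrow> 'e \<Rightarrow> 'e \<Rightarrow> real"

definition points :: "('m, 'e) riem \<Rightarrow> 'm set" where
  "points M = (\<Union>c\<in>atlas M. chart_dom c)"

text \<open>\<open>tcoord M c x v\<close>: coordinates in \<open>c\<close> of the tangent vector \<open>v\<close> at \<open>x\<close>;
  \<open>tvec M c x a\<close>: the tangent vector at \<open>x\<close> with coordinates \<open>a\<close> in \<open>c\<close>.\<close>

definition tcoord :: "('m, 'e::euclidean_space) riem \<Rightarrow> ('m, 'e) chart \<Rightarrow> 'm \<Rightarrow> 'e \<Rightarrow> 'e" where
  "tcoord M c x v =
     frechet_derivative (transition (chart_at M x) c) (at (chart_map (chart_at M x) x)) v"

definition tvec :: "('m, 'e::euclidean_space) riem \<Rightarrow> ('m, 'e) chart \<Rightarrow> 'm \<Rightarrow> 'e \<Rightarrow> 'e" where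
  "tvec M c x a = frechet_derivative (transition c (chart_at M x)) (at (chart_map c x)) a"

text \<open>The metric in the chart \<open>c\<close>, at the point with coordinates \<open>y\<close>.\<close>

definition gram :: "('m, 'e::euclidean_space) riem \<Rightarrow> ('m, 'e) chart \<Rightarrow> 'e \<Rightarrow> 'e \<Rightarrow> 'e \<Rightarrow> real" where
  "gram M c y v w =
     (let x = chart_inv c y in metric M x (tvec M c x v) (tvec M c x w))"

definition inner_product :: "('e::euclidean_space \<Rightarrow> 'e \<Rightarrow> real) \<Rightarrow> bool" where
  "inner_product g \<longleftrightarrow>
     bilinear g \<and> (\<forall>v w. g v w = g w v) \<and> (\<forall>v. v \<noteq> 0 \<longrightarrow> 0 < g v v)"

definition riemannian_manifold ::
  "('m::{t2_space, second_countable_topology}, 'e::euclidean_space) riem \<Rightarrow> bool" where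
  "riemannian_manifold M \<longleftrightarrow>
     (\<forall>c\<in>atlas M. is_chart c) \<and>
     (\<forall>c\<in>atlas M. \<forall>d\<in>atlas M.
        smooth_on (chart_map c ` (chart_dom c \<inter> chart_dom d)) (transition c d)) \<and>
     (\<forall>x\<in>points M. chart_at M x \<in> atlas M \<and> x \<in> chart_dom (chart_at M x)) \<and>
     (\<forall>x\<in>points M. inner_product (metric M x)) \<and>
     (\<forall>c\<in>atlas M. \<forall>v w. smooth_on (chart_im c) (\<lambda>y. gram M c y v w))"

text \<open>\<open>\<Gamma>(v, w)\<close>, the vector with components \<open>\<Gamma>\<^sup>k\<^sub>i\<^sub>j v\<^sup>i w\<^sup>j\<close>, for the Levi-Civita connection: the
  Koszul formula for constant coordinate fields \<open>v, w, z\<close> of the chart \<open>c\<close>.\<close>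

definition christoffel ::
  "('m, 'e::euclidean_space) riem \<Rightarrow> ('m, 'e) chart \<Rightarrow> 'e \<Rightarrow> 'e \<Rightarrow> 'e \<Rightarrow> 'e" where
  "christoffel M c y v w =
     (THE u. \<forall>z. gram M c y u z =
        (frechet_derivative (\<lambda>p. gram M c p w z) (at y) v
         + frechet_derivative (\<lambda>p. gram M c p v z) (at y) w
         - frechet_derivative (\<lambda>p. gram M c p v w) (at y) z) / 2)"

text \<open>\<open>cov_deriv M v Z x\<close> is \<open>(\<nabla>\<^sub>X Z)(x)\<close> for any vector field \<open>X\<close> with \<open>X(x) = v\<close>, computed in the
  chart \<open>chart_at M x\<close>.\<close>

definition cov_deriv :: "('m, 'e::euclidean_space) riem \<Rightarrow> 'e \<Rightarrow> ('m \<Rightarrow> 'e) \<Rightarrow> 'm \<Rightarrow> 'e" where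
  "cov_deriv M v Z x =
     (let c = chart_at M x;
          y = chart_map c x;
          Zc = (\<lambda>p. tcoord M c (chart_inv c p) (Z (chart_inv c p)))
      in frechet_derivative Zc (at y) v + christoffel M c y v (Zc y))"

definition differential :: "('m, 'e::euclidean_space) riem \<Rightarrow> ('m \<Rightarrow> real) \<Rightarrow> 'm \<Rightarrow> 'e \<Rightarrow> real" where
  "differential M \<phi> x v =
     frechet_derivative (\<phi> \<circ> chart_inv (chart_at M x)) (at (chart_map (chart_at M x) x)) v"

definition gradient :: "('m, 'e::euclidean_space) riem \<Rightarrow> ('m \<Rightarrow> real) \<Rightarrow> 'm \<Rightarrow> 'e" where
  "gradient M \<phi> x = (THE u. \<forall>w. metric M x u w = differential M \<phi> x w)"

definition hessian ::
  "('m, 'e::euclidean_space) riem \<Rightarrow> ('m \<Rightarrow> real) \<Rightarrow> 'm \<Rightarrow> 'e \<Rightarrow> 'e \<Rightarrow> real" where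
  "hessian M \<phi> x v w = metric M x (cov_deriv M v (gradient M \<phi>) x) w"

definition C2_on_manifold ::
  "('m, 'e::euclidean_space) riem \<Rightarrow> 'm set \<Rightarrow> ('m \<Rightarrow> real) \<Rightarrow> bool" where
  "C2_on_manifold M N \<phi> \<longleftrightarrow>
     (\<forall>c\<in>atlas M. Ck_on 2 (chart_map c ` (chart_dom c \<inter> N)) (\<phi> \<circ> chart_inv c))"

text \<open>The second order subjet \<open>J\<^sup>2\<^sup>,\<^sup>-f(x)\<close>; the test functions are only required to be \<open>C\<^sup>2\<close> near
  \<open>x\<close>.\<close>

definition subjet2 ::
  "('m::topological_space, 'e::euclidean_space) riem \<Rightarrow> ('m \<Rightarrow> ereal) \<Rightarrow> 'm \<Rightarrow>
     (('e \<Rightarrow> real) \<times> ('e \<Rightarrow> 'e \<Rightarrow> real)) set" where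
  "subjet2 M f x =
     {(differential M \<phi> x, hessian M \<phi> x) | \<phi>.
        (\<exists>N. open N \<and> x \<in> N \<and> N \<subseteq> points M \<and> C2_on_manifold M N \<phi>) \<and>
        (\<forall>\<^sub>F y in at x within points M. f x - ereal (\<phi> x) \<le> f y - ereal (\<phi> y))}"

definition lower_semicontinuous_on :: "'m::topological_space set \<Rightarrow> ('m \<Rightarrow> ereal) \<Rightarrow> bool" where
  "lower_semicontinuous_on S f \<longleftrightarrow>
     (\<forall>y\<in>S. \<forall>a. a < f y \<longrightarrow> (\<forall>\<^sub>F z in at y within S. a < f z))"


text \<open>\<open>\<gamma>\<close> is a geodesic on the open interval \<open>I\<close>, i.e. \<open>\<nabla>\<^sub>\<gamma>\<^sub>' \<gamma>' = 0\<close>, written out in every chart.\<close>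

definition geodesic_on ::
  "('m::topological_space, 'e::euclidean_space) riem \<Rightarrow> real set \<Rightarrow> (real \<Rightarrow> 'm) \<Rightarrow> bool" where
  "geodesic_on M I \<gamma> \<longleftrightarrow>
     open I \<and> is_interval I \<and> continuous_on I \<gamma> \<and> \<gamma> ` I \<subseteq> points M \<and>
     (\<forall>c\<in>atlas M. \<forall>t\<in>I. \<gamma> t \<in> chart_dom c \<longrightarrow>
        (let velocity = (\<lambda>s. vector_derivative (chart_map c \<circ> \<gamma>) (at s)) in
           (chart_map c \<circ> \<gamma>) differentiable (at t) \<and>
           (velocity has_vector_derivative
              - christoffel M c (chart_map c (\<gamma> t)) (velocity t) (velocity t)) (at t)))"

text \<open>\<open>exp_rel M x v p\<close>: the geodesic starting at \<open>x\<close> with velocity \<open>v\<close> exists up to time 1, where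
  it reaches \<open>p\<close>. The exponential map has a meaningful value on \<open>exp_domain M x\<close> only.\<close>

definition exp_rel ::
  "('m::topological_space, 'e::euclidean_space) riem \<Rightarrow> 'm \<Rightarrow> 'e \<Rightarrow> 'm \<Rightarrow> bool" where
  "exp_rel M x v p \<longleftrightarrow>
     (\<exists>I \<gamma>. geodesic_on M I \<gamma> \<and> {0..1} \<subseteq> I \<and> \<gamma> 0 = x \<and>
        vector_derivative (chart_map (chart_at M x) \<circ> \<gamma>) (at 0) = v \<and> \<gamma> 1 = p)"

definition exp_domain :: "('m::topological_space, 'e::euclidean_space) riem \<Rightarrow> 'm \<Rightarrow> 'e set" where
  "exp_domain M x = {v. \<exists>p. exp_rel M x v p}"

definition exp_map :: "('m::topological_space, 'e::euclidean_space) riem \<Rightarrow> 'm \<Rightarrow> 'e \<Rightarrow> 'm" where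
  "exp_map M x v = (THE p. exp_rel M x v p)"


text \<open>The tangent space at \<open>x\<close> as a flat Riemannian manifold, with the inner product given by the
  metric at \<open>x\<close>. Its only chart is the identity, so its tangent space at the origin is identified
  with the tangent space of \<open>M\<close> at \<open>x\<close>.\<close>

definition tangent_manifold ::
  "('m, 'e::euclidean_space) riem \<Rightarrow> 'm \<Rightarrow> ('e, 'e) riem" where
  "tangent_manifold M x =
     \<lparr>atlas = {(UNIV, id)}, chart_at = (\<lambda>_. (UNIV, id)), metric = (\<lambda>_. metric M x)\<rparr>"

definition restrict_chart :: "'m set \<Rightarrow> ('m, 'e) chart \<Rightarrow> ('m, 'e) chart" where
  "restrict_chart U c = (chart_dom c \<inter> U, chart_map c)"

definition open_submanifold :: "('m, 'e) riem \<Rightarrow> 'm set \<Rightarrow> ('m, 'e) riem" where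
  "open_submanifold M U =
     \<lparr>atlas = restrict_chart U ` atlas M, chart_at = (\<lambda>x. restrict_chart U (chart_at M x)),
      metric = metric M\<rparr>"

definition smooth_map ::
  "('m::topological_space, 'e::euclidean_space) riem \<Rightarrow>
   ('n::topological_space, 'f::euclidean_space) riem \<Rightarrow> ('m \<Rightarrow> 'n) \<Rightarrow> bool" where
  "smooth_map M N F \<longleftrightarrow>
     continuous_on (points M) F \<and> F ` points M \<subseteq> points N \<and>
     (\<forall>c\<in>atlas M. \<forall>d\<in>atlas N.
        smooth_on (chart_map c ` (chart_dom c \<inter> F -` chart_dom d))
          (chart_map d \<circ> F \<circ> chart_inv c))"

definition diffeomorphism ::
  "('m::topological_space, 'e::euclidean_space) riem \<Rightarrow>
   ('n::topological_space, 'f::euclidean_space) riem \<Rightarrow> ('m \<Rightarrow> 'n) \<Rightarrow> bool" where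
  "diffeomorphism M N F \<longleftrightarrow>
     bij_betw F (points M) (points N) \<and>
     smooth_map M N F \<and> smooth_map N M (inv_into (points M) F)"

definition diffeomorphism_onto_image ::
  "('m::topological_space, 'e::euclidean_space) riem \<Rightarrow>
   ('n::topological_space, 'f::euclidean_space) riem \<Rightarrow> ('m \<Rightarrow> 'n) \<Rightarrow> bool" where
  "diffeomorphism_onto_image M N F \<longleftrightarrow>
     F ` points M \<subseteq> points N \<and> open (F ` points M) \<and>
     diffeomorphism M (open_submanifold N (F ` points M)) F"

end

theory Submission
  imports Defs
begin

text \<open>Both subjets consist of the 2-jets of test functions that touch the function from below, so it
  is enough to match test functions and to see that matching ones have the same 2-jet. The
  exponential map is a diffeomorphism from \<open>U\<close> to a neighbourhood of \<open>x\<close>, hence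
  \<open>\<phi> \<mapsto> \<psi> = \<phi> \<circ> exp\<^sub>x\<close> is a bijection between germs of \<open>C\<^sup>2\<close> functions at \<open>x\<close> and at \<open>0\<close>,
  and local minima correspond to local minima. What remains is the equality of differentials and
  Hessians (\<open>jets_agree\<close>).

  In the chart at \<open>x\<close> let \<open>E\<close> be the coordinate expression of \<open>exp\<^sub>x\<close> and \<open>\<Gamma>\<close> the Christoffel form at
  \<open>x\<close>. The Hessian of \<open>\<phi>\<close> is \<open>D\<^sup>2\<phi> v w - D\<phi> (\<Gamma> v w)\<close> (\<open>hessian_in_chart\<close>); it is defined through the
  covariant derivative of the gradient, so this needs the differentiability of the
  solution of a linear system with variable coefficients (\<open>Ck_on_solution\<close>). The same formula on
  the flat tangent space, where \<open>\<Gamma> = 0\<close>, gives \<open>D\<^sup>2\<psi>\<close>. By the second order chain rule the two agree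
  once \<open>DE(0) = id\<close> and \<open>D\<^sup>2E(0) = - \<Gamma>\<close> (\<open>exp_map_second_order\<close>).

  These two identities are the geodesic equation at time \<open>0\<close>: the map \<open>exp\<^sub>x\<close> sends the ray \<open>t v\<close> to the
  geodesic with initial velocity \<open>v\<close> (\<open>exp_map_along_ray\<close>), whose acceleration is \<open>- \<Gamma> v v\<close>, and a
  symmetric bilinear form is determined by its diagonal. As \<open>exp\<^sub>x\<close> is defined by a definite
  description, the statement on rays rests on the uniqueness of geodesics (\<open>geodesic_unique\<close>), which
  comes from a Gronwall estimate in charts (\<open>ode_unique_right\<close>) and a continuation argument.\<close>

section \<open>Functions of class \<open>C\<^sup>k\<close>\<close>

lemma frechet_derivative_eqI:
  "(f has_derivative f') (at x) \<Longrightarrow> frechet_derivative f (at x) = f'"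
  using frechet_derivative_at by force

lemma Ck_on_SucD:
  assumes "Ck_on (Suc k) S f"
  shows "\<And>x. x \<in> S \<Longrightarrow> (f has_derivative frechet_derivative f (at x)) (at x)"
    and "\<And>v. Ck_on k S (\<lambda>x. frechet_derivative f (at x) v)"
  using assms by (auto simp: frechet_derivative_works)

lemma Ck_on_cong:
  assumes "Ck_on k S f" "open S" "\<And>x. x \<in> S \<Longrightarrow> f x = g x"
  shows "Ck_on k S g"
  using assms(1,3)
proof (induction k arbitrary: f g)
  case 0
  then show ?case by (simp cong: continuous_on_cong)
next
  case (Suc k)
  have der: "(g has_derivative frechet_derivative f (at x)) (at x)" if "x \<in> S" for x
    using has_derivative_transform_within_open[OF Ck_on_SucD(1)[OF Suc.prems(1) that] assms(2) that]
      Suc.prems(2) by simp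
  have "Ck_on k S (\<lambda>x. frechet_derivative g (at x) v)" for v
    by (rule Suc.IH[OF Ck_on_SucD(2)[OF Suc.prems(1)]]) (simp add: frechet_derivative_eqI[OF der])
  then show ?case
    using der by (auto simp: differentiable_def)
qed

lemma Ck_on_SucI:
  assumes "open S" "\<And>x. x \<in> S \<Longrightarrow> (f has_derivative f' x) (at x)"
    and "\<And>v. Ck_on k S (\<lambda>x. f' x v)"
  shows "Ck_on (Suc k) S f"
  using assms Ck_on_cong[OF assms(3) assms(1)]
  by (auto simp: differentiable_def frechet_derivative_eqI[OF assms(2)] intro: Ck_on_cong)

lemma Ck_on_subset: "Ck_on k S f \<Longrightarrow> T \<subseteq> S \<Longrightarrow> Ck_on k T f"
  by (induction k arbitrary: f) (auto intro: continuous_on_subset)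

lemma Ck_on_SucD': "Ck_on (Suc k) S f \<Longrightarrow> Ck_on k S f"
proof (induction k arbitrary: f)
  case 0
  then show ?case
    by (auto intro!: continuous_at_imp_continuous_on differentiable_imp_continuous_within)
qed auto

lemma Ck_on_mono: "Ck_on k S f \<Longrightarrow> j \<le> k \<Longrightarrow> Ck_on j S f"
  by (induction k) (auto simp: le_Suc_eq dest: Ck_on_SucD' simp del: Ck_on.simps(2))

lemma Ck_on_imp_continuous_on: "Ck_on k S f \<Longrightarrow> continuous_on S f"
  using Ck_on_mono[of k S f 0] by simp

lemma Ck_on_const: "Ck_on k S (\<lambda>_. c)"
  by (induction k arbitrary: c) auto

lemma Ck_on_bounded_linear:
  assumes "bounded_linear L" "open S" "Ck_on k S f"
  shows "Ck_on k S (\<lambda>x. L (f x))"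
  using assms(3)
proof (induction k arbitrary: f)
  case 0
  then show ?case
    using bounded_linear.continuous_on[OF assms(1)] by simp
next
  case (Suc k)
  show ?case
    by (rule Ck_on_SucI[OF assms(2) bounded_linear.has_derivative[OF assms(1) Ck_on_SucD(1)[OF Suc.prems]]])
      (auto intro!: Suc.IH Ck_on_SucD(2)[OF Suc.prems])
qed

lemma Ck_on_linear: "linear (L :: 'a::euclidean_space \<Rightarrow> 'b::euclidean_space) \<Longrightarrow> Ck_on k S L"
  by (cases k) (auto simp: linear_conv_bounded_linear linear_continuous_on bounded_linear_imp_differentiable
      frechet_derivative_eqI[OF bounded_linear_imp_has_derivative] Ck_on_const)

lemma Ck_on_add:
  assumes "open S" "Ck_on k S f" "Ck_on k S g"
  shows "Ck_on k S (\<lambda>x. f x + g x)"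
  using assms(2,3)
proof (induction k arbitrary: f g)
  case (Suc k)
  show ?case
    by (rule Ck_on_SucI[OF assms(1) has_derivative_add[OF Suc.prems[THEN Ck_on_SucD(1)]]])
      (auto intro!: Suc.IH Suc.prems[THEN Ck_on_SucD(2)])
qed (auto intro: continuous_intros)

lemma Ck_on_sum:
  assumes "open S" "\<And>i. i \<in> I \<Longrightarrow> Ck_on k S (f i)"
  shows "Ck_on k S (\<lambda>x. \<Sum>i\<in>I. f i x)"
  using assms(2) by (induction I rule: infinite_finite_induct) (auto intro: Ck_on_const Ck_on_add assms(1))

lemma Ck_on_bilinear:
  assumes "bounded_bilinear mul" "open S" "Ck_on k S f" "Ck_on k S g"
  shows "Ck_on k S (\<lambda>x. mul (f x) (g x))"
  using assms(3,4)
proof (induction k arbitrary: f g)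
  case 0
  then show ?case
    using bounded_bilinear.continuous_on[OF assms(1)] by simp
next
  case (Suc k)
  show ?case
    by (rule Ck_on_SucI[OF assms(2) bounded_bilinear.FDERIV[OF assms(1) Suc.prems[THEN Ck_on_SucD(1)]]])
      (auto intro!: Suc.IH Ck_on_add assms(2) Suc.prems[THEN Ck_on_SucD'] Suc.prems[THEN Ck_on_SucD(2)])
qed

lemmas Ck_on_scaleR = Ck_on_bilinear[OF bounded_bilinear_scaleR]
lemmas Ck_on_mult = Ck_on_bilinear[OF bounded_bilinear_mult]

lemma Ck_on_diff:
  "open S \<Longrightarrow> Ck_on k S f \<Longrightarrow> Ck_on k S g \<Longrightarrow> Ck_on k S (\<lambda>x. f x - g x)"
  using Ck_on_add[of S k f "\<lambda>x. - g x"] Ck_on_bounded_linear[OF bounded_linear_minus[OF bounded_linear_ident], of S k g]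
  by simp

lemma linear_eq_sum_Basis:
  fixes L :: "'a::euclidean_space \<Rightarrow> 'b::real_vector"
  assumes "linear L"
  shows "L a = (\<Sum>i\<in>Basis. (a \<bullet> i) *\<^sub>R L i)"
proof -
  have "L a = L (\<Sum>i\<in>Basis. (a \<bullet> i) *\<^sub>R i)" by (simp add: euclidean_representation)
  also have "\<dots> = (\<Sum>i\<in>Basis. (a \<bullet> i) *\<^sub>R L i)"
    by (simp add: linear_sum[OF assms] linear_cmul[OF assms])
  finally show ?thesis .
qed

text \<open>By the chain rule \<open>D(g \<circ> h) v = (\<Sum>i. (Dh v \<bullet> i) *\<^sub>R (D\<^sub>i g \<circ> h))\<close>, so that the claim for
  \<open>g\<close> of class \<open>C\<^sup>k\<^sup>+\<^sup>1\<close> reduces to the one for its partial derivatives.\<close>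

lemma Ck_on_compose:
  assumes "open S" "open T" "h ` S \<subseteq> T" "Ck_on k T g" "Ck_on k S h"
  shows "Ck_on k S (\<lambda>x. g (h x))"
  using assms(4,5)
proof (induction k arbitrary: g)
  case 0
  then show ?case
    using assms(3) continuous_on_compose2 by auto
next
  case (Suc k)
  let ?D = "\<lambda>x v. \<Sum>i\<in>Basis. (frechet_derivative h (at x) v \<bullet> i) *\<^sub>R frechet_derivative g (at (h x)) i"
  show ?case
  proof (rule Ck_on_SucI[OF assms(1)])
    fix x assume x: "x \<in> S"
    have g: "(g has_derivative frechet_derivative g (at (h x))) (at (h x))"
      using assms(3) x by (intro Ck_on_SucD(1)[OF Suc.prems(1)]) auto
    show "((\<lambda>x. g (h x)) has_derivative ?D x) (at x)"
      using has_derivative_compose[OF Ck_on_SucD(1)[OF Suc.prems(2) x] g]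
      by (subst (asm) linear_eq_sum_Basis[OF has_derivative_linear[OF g]])
  next
    fix v
    show "Ck_on k S (\<lambda>x. ?D x v)"
      by (intro Ck_on_sum Ck_on_scaleR assms(1) Suc.IH Ck_on_SucD(2)[OF Suc.prems(1)]
          Ck_on_SucD'[OF Suc.prems(2)] Ck_on_bounded_linear[OF bounded_linear_inner_left]
          Ck_on_SucD(2)[OF Suc.prems(2)])
  qed
qed

text \<open>The second difference of \<open>f\<close> over the parallelogram spanned by \<open>h v\<close> and \<open>h w\<close> is symmetric
  in \<open>v\<close> and \<open>w\<close>, and two applications of the mean value theorem express it by a second
  derivative at some point of the parallelogram.\<close>

lemma second_difference_mvt:
  fixes f :: "'a::euclidean_space \<Rightarrow> real"
  assumes "Ck_on 2 S f" "0 < h"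
    and S: "\<And>s t. 0 \<le> s \<Longrightarrow> s \<le> h \<Longrightarrow> 0 \<le> t \<Longrightarrow> t \<le> h \<Longrightarrow> x + s *\<^sub>R v + t *\<^sub>R w \<in> S"
  shows "\<exists>s t. 0 \<le> s \<and> s \<le> h \<and> 0 \<le> t \<and> t \<le> h \<and>
    f (x + h *\<^sub>R v + h *\<^sub>R w) - f (x + h *\<^sub>R v) - f (x + h *\<^sub>R w) + f x =
    h * (h * frechet_derivative (\<lambda>p. frechet_derivative f (at p) v) (at (x + s *\<^sub>R v + t *\<^sub>R w)) w)"
proof -
  have C2: "Ck_on (Suc (Suc 0)) S f" using assms(1) by (simp add: numeral_2_eq_2)
  let ?D = "\<lambda>p. frechet_derivative f (at p) v"
  let ?DD = "\<lambda>p. frechet_derivative ?D (at p) w"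
  define g where "g = (\<lambda>s. f (x + s *\<^sub>R v + h *\<^sub>R w) - f (x + s *\<^sub>R v))"
  have f1: "((\<lambda>s. f (x + s *\<^sub>R v + t *\<^sub>R w)) has_derivative (\<lambda>d. d * ?D (x + s *\<^sub>R v + t *\<^sub>R w))) (at s within A)"
    if "0 \<le> s" "s \<le> h" "0 \<le> t" "t \<le> h" for s t A
  proof -
    have f: "(f has_derivative frechet_derivative f (at (x + s *\<^sub>R v + t *\<^sub>R w))) (at (x + s *\<^sub>R v + t *\<^sub>R w))"
      using Ck_on_SucD(1)[OF C2] S that by blast
    have "((\<lambda>s. x + s *\<^sub>R v + t *\<^sub>R w) has_derivative (\<lambda>d. d *\<^sub>R v)) (at s within A)"
      by (auto intro!: derivative_eq_intros)
    from has_derivative_compose[OF this f] show ?thesis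
      by (simp add: linear_cmul[OF has_derivative_linear[OF f]])
  qed
  have g': "(g has_derivative (\<lambda>d. d * (?D (x + s *\<^sub>R v + h *\<^sub>R w) - ?D (x + s *\<^sub>R v)))) (at s within {0..h})"
    if "0 \<le> s" "s \<le> h" for s
    unfolding g_def right_diff_distrib
    using has_derivative_diff[OF f1[OF that, of h] f1[OF that, of 0]] assms(2) by simp
  obtain s where s: "0 < s" "s < h" "g h - g 0 = h * (?D (x + s *\<^sub>R v + h *\<^sub>R w) - ?D (x + s *\<^sub>R v))"
    using mvt_simple[OF assms(2) g'] by auto
  have f2: "((\<lambda>t. ?D (x + s *\<^sub>R v + t *\<^sub>R w)) has_derivative (\<lambda>d. d * ?DD (x + s *\<^sub>R v + t *\<^sub>R w))) (at t within {0..h})"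
    if "0 \<le> t" "t \<le> h" for t
  proof -
    have f: "(?D has_derivative frechet_derivative ?D (at (x + s *\<^sub>R v + t *\<^sub>R w))) (at (x + s *\<^sub>R v + t *\<^sub>R w))"
      using Ck_on_SucD(1)[OF Ck_on_SucD(2)[OF C2]] S that s by simp
    have "((\<lambda>t. x + s *\<^sub>R v + t *\<^sub>R w) has_derivative (\<lambda>d. d *\<^sub>R w)) (at t within {0..h})"
      by (auto intro!: derivative_eq_intros)
    from has_derivative_compose[OF this f] show ?thesis
      by (simp add: linear_cmul[OF has_derivative_linear[OF f]])
  qed
  obtain t where t: "0 < t" "t < h"
    "?D (x + s *\<^sub>R v + h *\<^sub>R w) - ?D (x + s *\<^sub>R v) = h * ?DD (x + s *\<^sub>R v + t *\<^sub>R w)"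
    using mvt_simple[OF assms(2) f2] by auto
  have "f (x + h *\<^sub>R v + h *\<^sub>R w) - f (x + h *\<^sub>R v) - f (x + h *\<^sub>R w) + f x = g h - g 0"
    by (simp add: g_def)
  then show ?thesis
    using s t by (intro exI[of _ s] exI[of _ t]) simp
qed

lemma second_derivative_symmetric_real:
  fixes f :: "'a::euclidean_space \<Rightarrow> real"
  assumes C2: "Ck_on 2 S f" and "open S" "x \<in> S"
  shows "frechet_derivative (\<lambda>p. frechet_derivative f (at p) v) (at x) w =
         frechet_derivative (\<lambda>p. frechet_derivative f (at p) w) (at x) v"
proof -
  let ?D = "\<lambda>v w p. frechet_derivative (\<lambda>p. frechet_derivative f (at p) v) (at p) w"
  have cont: "(?D v w \<longlongrightarrow> ?D v w x) (nhds x)" for v w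
  proof -
    have "isCont (?D v w) x"
      using C2 assms(2,3) by (auto simp: numeral_2_eq_2 continuous_on_eq_continuous_at)
    then show ?thesis
      unfolding isCont_def by (rule tendsto_at_iff_tendsto_nhds[THEN iffD1])
  qed
  have "\<bar>?D v w x - ?D w v x\<bar> < e" if "e > 0" for e
  proof -
    have "\<forall>\<^sub>F p in nhds x. dist (?D v w p) (?D v w x) < e / 2 \<and> dist (?D w v p) (?D w v x) < e / 2 \<and> p \<in> S"
      using cont[of v w] cont[of w v] assms(2,3) that
      by (intro eventually_conj tendstoD[OF cont]) (auto simp: eventually_nhds_in_open)
    then obtain d where d: "d > 0" "\<And>p. dist p x < d \<Longrightarrow> dist (?D v w p) (?D v w x) < e / 2 \<and>
        dist (?D w v p) (?D w v x) < e / 2 \<and> p \<in> S"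
      by (auto simp: eventually_nhds_metric)
    define h where "h = d / (2 * (norm v + norm w + 1))"
    have pos: "norm v + norm w + 1 > 0" by (simp add: add_nonneg_pos)
    then have h: "h > 0" using d(1) by (simp add: h_def)
    have near: "dist (x + s *\<^sub>R v + t *\<^sub>R w) x < d" if "0 \<le> s" "s \<le> h" "0 \<le> t" "t \<le> h" for s t
    proof -
      have "norm (s *\<^sub>R v + t *\<^sub>R w) \<le> s * norm v + t * norm w"
        using norm_triangle_ineq[of "s *\<^sub>R v" "t *\<^sub>R w"] that by simp
      also have "\<dots> \<le> h * norm v + h * norm w"
        using that by (intro add_mono mult_right_mono) auto
      also have "\<dots> \<le> h * (norm v + norm w + 1)" using h by (simp add: algebra_simps)
      also have "\<dots> = d / 2" using pos by (simp add: h_def divide_simps)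
      finally show ?thesis using d(1) by (simp add: dist_norm add.assoc)
    qed
    have near': "dist (x + s *\<^sub>R w + t *\<^sub>R v) x < d" if "0 \<le> s" "s \<le> h" "0 \<le> t" "t \<le> h" for s t
      using near[OF that(3,4,1,2)] by (simp add: add_ac)
    obtain s t where st: "0 \<le> s" "s \<le> h" "0 \<le> t" "t \<le> h"
      "f (x + h *\<^sub>R v + h *\<^sub>R w) - f (x + h *\<^sub>R v) - f (x + h *\<^sub>R w) + f x =
       h * (h * ?D v w (x + s *\<^sub>R v + t *\<^sub>R w))"
      using second_difference_mvt[OF C2 h, of x v w] near d(2) by blast
    obtain s' t' where st': "0 \<le> s'" "s' \<le> h" "0 \<le> t'" "t' \<le> h"
      "f (x + h *\<^sub>R w + h *\<^sub>R v) - f (x + h *\<^sub>R w) - f (x + h *\<^sub>R v) + f x =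
       h * (h * ?D w v (x + s' *\<^sub>R w + t' *\<^sub>R v))"
      using second_difference_mvt[OF C2 h, of x w v] near' d(2) by blast
    have "x + h *\<^sub>R w + h *\<^sub>R v = x + h *\<^sub>R v + h *\<^sub>R w" by (simp add: add_ac)
    with st(5) st'(5) have "h * (h * ?D v w (x + s *\<^sub>R v + t *\<^sub>R w)) = h * (h * ?D w v (x + s' *\<^sub>R w + t' *\<^sub>R v))"
      by (simp only:)
    then have "?D v w (x + s *\<^sub>R v + t *\<^sub>R w) = ?D w v (x + s' *\<^sub>R w + t' *\<^sub>R v)" using h by simp
    moreover have "dist (?D v w (x + s *\<^sub>R v + t *\<^sub>R w)) (?D v w x) < e / 2"
      using d(2)[OF near[OF st(1-4)]] by blast
    moreover have "dist (?D w v (x + s' *\<^sub>R w + t' *\<^sub>R v)) (?D w v x) < e / 2"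
      using d(2)[OF near'[OF st'(1-4)]] by blast
    ultimately show ?thesis unfolding dist_real_def by linarith
  qed
  from this[of "\<bar>?D v w x - ?D w v x\<bar>"] show ?thesis by force
qed

lemma second_derivative_symmetric:
  fixes f :: "'a::euclidean_space \<Rightarrow> 'b::euclidean_space"
  assumes C2: "Ck_on 2 S f" and S: "open S" "x \<in> S"
  shows "frechet_derivative (\<lambda>p. frechet_derivative f (at p) v) (at x) w =
         frechet_derivative (\<lambda>p. frechet_derivative f (at p) w) (at x) v"
proof (rule euclidean_eqI)
  fix b :: 'b assume "b \<in> Basis"
  have C2': "Ck_on (Suc (Suc 0)) S f" using C2 by (simp add: numeral_2_eq_2)
  have 1: "frechet_derivative (\<lambda>p. f p \<bullet> b) (at p) v = frechet_derivative f (at p) v \<bullet> b" if "p \<in> S" for p v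
    by (subst frechet_derivative_eqI[OF has_derivative_inner_left[OF Ck_on_SucD(1)[OF C2' that]]]) simp
  have 2: "frechet_derivative (\<lambda>p. frechet_derivative f (at p) v) (at x) w \<bullet> b =
      frechet_derivative (\<lambda>p. frechet_derivative (\<lambda>p. f p \<bullet> b) (at p) v) (at x) w" for v w
  proof -
    have "((\<lambda>p. frechet_derivative (\<lambda>p. f p \<bullet> b) (at p) v) has_derivative
       (\<lambda>w. frechet_derivative (\<lambda>p. frechet_derivative f (at p) v) (at x) w \<bullet> b)) (at x)"
      by (rule has_derivative_transform_within_open[OF
          has_derivative_inner_left[OF Ck_on_SucD(1)[OF Ck_on_SucD(2)[OF C2'] S(2)]] S])
        (simp add: 1)
    from frechet_derivative_eqI[OF this] show ?thesis by simp
  qed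
  show "frechet_derivative (\<lambda>p. frechet_derivative f (at p) v) (at x) w \<bullet> b =
      frechet_derivative (\<lambda>p. frechet_derivative f (at p) w) (at x) v \<bullet> b"
    unfolding 2
    by (rule second_derivative_symmetric_real[OF Ck_on_bounded_linear[OF bounded_linear_inner_left S(1) C2] S])
qed

section \<open>Solving a linear system with variable coefficients\<close>

lemma bilinear_eq_sum_Basis:
  fixes G :: "'a::euclidean_space \<Rightarrow> 'b::euclidean_space \<Rightarrow> 'c::real_vector"
  assumes "bilinear G"
  shows "G a b = (\<Sum>i\<in>Basis. \<Sum>j\<in>Basis. ((a \<bullet> i) * (b \<bullet> j)) *\<^sub>R G i j)"
proof -
  have lin: "linear (\<lambda>a. G a b)" "\<And>i. linear (G i)"
    using assms by (auto simp: bilinear_def)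
  have "G a b = (\<Sum>i\<in>Basis. (a \<bullet> i) *\<^sub>R G i b)"
    by (rule linear_eq_sum_Basis[OF lin(1)])
  also have "\<dots> = (\<Sum>i\<in>Basis. (a \<bullet> i) *\<^sub>R (\<Sum>j\<in>Basis. (b \<bullet> j) *\<^sub>R G i j))"
    by (subst linear_eq_sum_Basis[OF lin(2), of _ b]) simp
  finally show ?thesis by (simp add: scaleR_sum_right)
qed

lemma inner_product_bilinear: "inner_product g \<Longrightarrow> bilinear g"
  by (simp add: inner_product_def)

lemma inner_product_commute: "inner_product g \<Longrightarrow> g v w = g w v"
  unfolding inner_product_def by blast

lemma inner_product_linear:
  assumes "inner_product g"
  shows "linear (\<lambda>a. g a b)" "linear (g a)"
  using assms by (auto simp: inner_product_def bilinear_def)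

lemma inner_product_expand:
  assumes "inner_product g"
  shows "g a b = (\<Sum>i\<in>Basis. (a \<bullet> i) * g i b)" "g a b = (\<Sum>i\<in>Basis. (b \<bullet> i) * g a i)"
  using linear_eq_sum_Basis[OF inner_product_linear(1)[OF assms, of b], of a]
    linear_eq_sum_Basis[OF inner_product_linear(2)[OF assms, of a], of b] by simp_all

lemma inner_product_eqI:
  assumes "inner_product g" "\<And>z. g u z = g v z"
  shows "u = v"
proof (rule ccontr)
  assume "u \<noteq> v"
  then have "g (u - v) (u - v) > 0" using assms(1) by (simp add: inner_product_def)
  moreover have "g (u - v) (u - v) = 0"
    using bilinear_lsub[OF inner_product_bilinear[OF assms(1)]] assms(2) by simp
  ultimately show False by simp
qed

lemma inner_product_representation:
  assumes g: "inner_product g" and "linear l"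
  shows "\<exists>!u. \<forall>z. g u z = l z"
proof -
  let ?L = "\<lambda>u. \<Sum>b\<in>Basis. g u b *\<^sub>R b"
  note lin = inner_product_linear[OF g]
  have lin_L: "linear ?L"
    by (rule linearI) (simp_all add: linear_add[OF lin(1)] linear_cmul[OF lin(1)]
        scaleR_add_left sum.distrib scaleR_sum_right)
  have comp: "?L u \<bullet> b = g u b" if "b \<in> Basis" for u b
    using that by simp
  have eq: "g u z = l' z" if "\<And>b. b \<in> Basis \<Longrightarrow> g u b = l' b" "linear l'" for u l' z
    using linear_eq_on_span[OF lin(2) that(2), of Basis u z] that(1) by auto
  have "inj ?L"
  proof (rule injI)
    fix u v assume "?L u = ?L v"
    then have "g u b = g v b" if "b \<in> Basis" for b
      using comp[OF that] by metis
    from eq[OF this lin(2)] show "u = v" by (rule inner_product_eqI[OF g])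
  qed
  then have "surj ?L"
    using lin_L linear_injective_imp_surjective by blast
  from surjD[OF this] obtain u where u: "(\<Sum>b\<in>Basis. l b *\<^sub>R b) = ?L u" by (rule exE)
  have "g u b = l b" if "b \<in> Basis" for b
    using comp[OF that, of u, folded u] that by simp
  from eq[OF this assms(2)] show ?thesis
    by (intro ex1I[of _ u]) (auto intro: inner_product_eqI[OF g])
qed

lemma inner_product_coercive:
  assumes g: "inner_product g"
  shows "\<exists>m>0. \<forall>a. m * (norm a)\<^sup>2 \<le> g a a"
proof -
  note bil = inner_product_bilinear[OF g]
  have "continuous_on (sphere 0 1) (\<lambda>a. g a a)"
    by (subst bilinear_eq_sum_Basis[OF bil]) (intro continuous_intros)
  moreover obtain b :: 'a where "b \<in> Basis" using nonempty_Basis by blast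
  then have "sphere (0 :: 'a) 1 \<noteq> {}" by (force simp: norm_Basis)
  ultimately obtain a0 where a0: "a0 \<in> sphere 0 1" "\<And>a. a \<in> sphere 0 1 \<Longrightarrow> g a0 a0 \<le> g a a"
    using continuous_attains_inf[OF compact_sphere] by blast
  have "a0 \<noteq> 0" using a0(1) by auto
  then have "g a0 a0 > 0" using g by (simp add: inner_product_def)
  moreover have "g a0 a0 * (norm a)\<^sup>2 \<le> g a a" for a
  proof (cases "a = 0")
    case False
    have "g a0 a0 \<le> g (a /\<^sub>R norm a) (a /\<^sub>R norm a)"
      using a0(2) False by simp
    also have "\<dots> = g a a / (norm a)\<^sup>2"
      by (simp add: bilinear_lmul[OF bil] bilinear_rmul[OF bil] power2_eq_square divide_inverse)
    finally show ?thesis using False by (simp add: field_simps)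
  qed (simp add: bilinear_lzero[OF bil])
  ultimately show ?thesis by blast
qed

text \<open>Positive definiteness of the Gram matrix is stable: the coercivity constant at \<open>y\<^sub>0\<close> works
  up to a factor \<open>1/2\<close> at the neighbouring points.\<close>

lemma inner_product_coercive_near:
  fixes G :: "'a::t2_space \<Rightarrow> 'e::euclidean_space \<Rightarrow> 'e \<Rightarrow> real"
  assumes G: "\<And>y. y \<in> S \<Longrightarrow> inner_product (G y)" and S: "open S" "y0 \<in> S"
    and cont: "\<And>a b. continuous_on S (\<lambda>y. G y a b)"
  shows "\<exists>m>0. \<forall>\<^sub>F y in nhds y0. \<forall>a. m * (norm a)\<^sup>2 \<le> G y a a"
proof -
  obtain m where m: "m > 0" "\<And>a. m * (norm a)\<^sup>2 \<le> G y0 a a"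
    using inner_product_coercive[OF G[OF S(2)]] by blast
  let ?d = "\<lambda>y. \<Sum>i\<in>Basis. \<Sum>j\<in>Basis. \<bar>G y i j - G y0 i j\<bar>"
  have "isCont ?d y0"
    using cont S by (intro continuous_intros) (auto simp: continuous_on_eq_continuous_at)
  then have "(?d \<longlongrightarrow> ?d y0) (nhds y0)"
    unfolding isCont_def by (rule tendsto_at_iff_tendsto_nhds[THEN iffD1])
  then have "\<forall>\<^sub>F y in nhds y0. ?d y < m / 2"
    by (rule order_tendstoD) (use m in simp)
  then have "\<forall>\<^sub>F y in nhds y0. \<forall>a. m / 2 * (norm a)\<^sup>2 \<le> G y a a"
    using eventually_nhds_in_open[OF S]
  proof eventually_elim
    case (elim y)
    show ?case
    proof
      fix a
      have "\<bar>G y a a - G y0 a a\<bar> = \<bar>\<Sum>i\<in>Basis. \<Sum>j\<in>Basis. (a \<bullet> i) * (a \<bullet> j) * (G y i j - G y0 i j)\<bar>"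
        by (subst (1 2) bilinear_eq_sum_Basis[OF inner_product_bilinear[OF G]])
          (use elim S in \<open>auto simp: sum_subtractf right_diff_distrib\<close>)
      also have "\<dots> \<le> (\<Sum>i\<in>Basis. \<Sum>j\<in>Basis. \<bar>(a \<bullet> i) * (a \<bullet> j) * (G y i j - G y0 i j)\<bar>)"
        by (rule order_trans[OF sum_abs sum_mono[OF sum_abs]])
      also have "\<dots> \<le> (\<Sum>i\<in>Basis. \<Sum>j\<in>Basis. (norm a)\<^sup>2 * \<bar>G y i j - G y0 i j\<bar>)"
        by (intro sum_mono) (auto simp: abs_mult power2_eq_square Basis_le_norm intro!: mult_right_mono mult_mono)
      also have "\<dots> = (norm a)\<^sup>2 * ?d y" by (simp add: sum_distrib_left)
      also have "\<dots> \<le> (norm a)\<^sup>2 * (m / 2)"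
        using elim by (intro mult_left_mono) auto
      finally show "m / 2 * (norm a)\<^sup>2 \<le> G y a a" using m(2)[of a] unfolding abs_le_iff by (simp add: field_simps)
    qed
  qed
  then show ?thesis using m(1) by (intro exI[of _ "m / 2"]) simp
qed

text \<open>Coercivity bounds \<open>a = Z y - Z y\<^sub>0\<close> by the values of the form \<open>G y a\<close>, which is
  \<open>G y (Z y) - G y (Z y\<^sub>0)\<close> and tends to \<open>0\<close>.\<close>

lemma solution_continuous:
  fixes G :: "'a::t2_space \<Rightarrow> 'e::euclidean_space \<Rightarrow> 'e \<Rightarrow> real"
  assumes G: "\<And>y. y \<in> S \<Longrightarrow> inner_product (G y)" and S: "open S"
    and cont: "\<And>a b. continuous_on S (\<lambda>y. G y a b)"
    and rhs: "\<And>b. continuous_on S (\<lambda>y. G y (Z y) b)"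
  shows "continuous_on S Z"
  unfolding continuous_on_eq_continuous_at[OF S]
proof
  fix y0 assume y0: "y0 \<in> S"
  obtain m where m: "m > 0" "\<forall>\<^sub>F y in nhds y0. \<forall>a. m * (norm a)\<^sup>2 \<le> G y a a"
    using inner_product_coercive_near[OF G S y0 cont] by blast
  let ?r = "\<lambda>b y. G y (Z y) b - G y (Z y0) b"
  let ?R = "\<lambda>y. (\<Sum>b\<in>Basis. \<bar>?r b y\<bar>) / m"
  have "isCont ?R y0"
    using cont rhs y0 S m(1) by (intro continuous_intros) (auto simp: continuous_on_eq_continuous_at)
  then have "(?R \<longlongrightarrow> 0) (at y0)"
    using isContD by fastforce
  moreover have "\<forall>\<^sub>F y in at y0. norm (Z y - Z y0) \<le> ?R y"
    unfolding eventually_at_filter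
    using m(2) eventually_nhds_in_open[OF S y0]
  proof eventually_elim
    case (elim y)
    note bil = inner_product_bilinear[OF G[OF elim(2)]]
    let ?a = "Z y - Z y0"
    have "m * (norm ?a)\<^sup>2 \<le> G y ?a ?a" using elim by blast
    also have "\<dots> = (\<Sum>b\<in>Basis. (?a \<bullet> b) * G y ?a b)"
      by (rule inner_product_expand(2)[OF G[OF elim(2)]])
    also have "\<dots> = (\<Sum>b\<in>Basis. (?a \<bullet> b) * ?r b y)"
      by (simp add: bilinear_lsub[OF bil])
    also have "\<dots> \<le> (\<Sum>b\<in>Basis. norm ?a * \<bar>?r b y\<bar>)"
    proof (rule sum_mono)
      fix b :: 'e assume "b \<in> Basis"
      then have "\<bar>?a \<bullet> b\<bar> * \<bar>?r b y\<bar> \<le> norm ?a * \<bar>?r b y\<bar>"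
        by (intro mult_right_mono) (auto simp: Basis_le_norm)
      then show "(?a \<bullet> b) * ?r b y \<le> norm ?a * \<bar>?r b y\<bar>"
        unfolding abs_mult[symmetric] by (rule order_trans[OF abs_ge_self])
    qed
    finally have "norm ?a * (m * norm ?a) \<le> norm ?a * (\<Sum>b\<in>Basis. \<bar>?r b y\<bar>)"
      by (simp add: sum_distrib_left power2_eq_square algebra_simps)
    then have "m * norm ?a \<le> (\<Sum>b\<in>Basis. \<bar>?r b y\<bar>)"
      by (cases "norm ?a = 0") (auto simp: sum_nonneg)
    then show ?case using m(1) by (simp add: field_simps)
  qed
  ultimately have "((\<lambda>y. Z y - Z y0) \<longlongrightarrow> 0) (at y0)"
    by (rule Lim_null_comparison[rotated])
  then show "isCont Z y0"
    by (simp add: isCont_def LIM_zero_iff)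
qed

lemma has_derivative_mult_vanishing:
  fixes u w :: "'a::real_normed_vector \<Rightarrow> real"
  assumes u: "(u has_derivative u') (at x)" "u x = 0" and w: "isCont w x" "w x = 0"
  shows "((\<lambda>y. w y * u y) has_derivative (\<lambda>_. 0)) (at x)"
  unfolding has_derivative_at_alt
proof (intro conjI allI impI)
  fix e :: real assume e: "e > 0"
  obtain K where K: "K > 0" "\<And>h. norm (u' h) \<le> norm h * K"
    using bounded_linear.pos_bounded[OF has_derivative_bounded_linear[OF u(1)]] by blast
  obtain d1 where d1: "d1 > 0" "\<And>y. norm (y - x) < d1 \<Longrightarrow> \<bar>u y - u' (y - x)\<bar> \<le> norm (y - x)"
    using u unfolding has_derivative_at_alt by (auto elim: allE[of _ 1])
  obtain d2 where d2: "d2 > 0" "\<And>y. norm (y - x) < d2 \<Longrightarrow> \<bar>w y\<bar> < e / (K + 1)"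
    using w e K(1) unfolding continuous_at_eps_delta by (auto elim!: allE[of _ "e / (K + 1)"] simp: dist_norm)
  show "\<exists>d>0. \<forall>y. norm (y - x) < d \<longrightarrow> norm (w y * u y - w x * u x - 0) \<le> e * norm (y - x)"
  proof (intro exI[of _ "min d1 d2"] conjI allI impI)
    fix y assume y: "norm (y - x) < min d1 d2"
    have "\<bar>u y\<bar> \<le> norm (y - x) + norm (y - x) * K"
      using d1(2)[of y] K(2)[of "y - x"] y by auto
    then have "\<bar>w y\<bar> * \<bar>u y\<bar> \<le> e / (K + 1) * (norm (y - x) * (K + 1))"
      using d2(2)[of y] y K(1) e by (intro mult_mono) (auto simp: algebra_simps)
    also have "\<dots> = e * norm (y - x)" using K(1) by simp
    finally show "norm (w y * u y - w x * u x - 0) \<le> e * norm (y - x)"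
      using u(2) by (simp add: abs_mult)
  qed (use d1 d2 in simp)
qed simp

text \<open>Let \<open>c\<^sub>b\<close> be the dual basis of \<open>Basis\<close> with respect to \<open>G y\<^sub>0\<close>, so that
  \<open>a = (\<Sum>b. G y\<^sub>0 a b *\<^sub>R c\<^sub>b)\<close>. For \<open>a = Z y - Z y\<^sub>0\<close> the coefficient \<open>G y\<^sub>0 a b\<close> is the function
  \<open>G y (Z y) b - G y (Z y\<^sub>0) b\<close>, which is differentiable at \<open>y\<^sub>0\<close>, minus
  \<open>(G y - G y\<^sub>0) (Z y - Z y\<^sub>0) b\<close>, which is a product of a differentiable and a continuous factor
  that both vanish at \<open>y\<^sub>0\<close>.\<close>

lemma solution_differentiable:
  assumes G: "\<And>y. y \<in> S \<Longrightarrow> inner_product (G y)" and S: "open S" "y0 \<in> S"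
    and diff: "\<And>a b. (\<lambda>y. G y a b) differentiable (at y0)"
    and rhs: "\<And>b. (\<lambda>y. G y (Z y) b) differentiable (at y0)"
    and cont: "isCont Z y0"
  shows "Z differentiable (at y0)"
proof -
  note G0 = G[OF S(2)]
  have "\<exists>c. \<forall>z. G y0 c z = z \<bullet> b" for b
    by (rule ex1_implies_ex[OF inner_product_representation[OF G0 bounded_linear.linear[OF bounded_linear_inner_left]]])
  then obtain c where c: "\<And>b z. G y0 (c b) z = z \<bullet> b" by metis
  have expand: "a = (\<Sum>b\<in>Basis. G y0 a b *\<^sub>R c b)" for a
  proof (rule inner_product_eqI[OF G0])
    fix z
    have "G y0 (\<Sum>b\<in>Basis. G y0 a b *\<^sub>R c b) z = (\<Sum>b\<in>Basis. (z \<bullet> b) * G y0 a b)"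
      by (simp add: linear_sum[OF inner_product_linear(1)[OF G0]]
          linear_cmul[OF inner_product_linear(1)[OF G0]] c mult.commute)
    then show "G y0 a z = G y0 (\<Sum>b\<in>Basis. G y0 a b *\<^sub>R c b) z"
      using inner_product_expand(2)[OF G0, of a z] by simp
  qed
  let ?rem = "\<lambda>b y. \<Sum>i\<in>Basis. ((Z y - Z y0) \<bullet> i) * (G y i b - G y0 i b)"
  have rem: "?rem b differentiable (at y0)" for b
  proof -
    have "((\<lambda>y. ((Z y - Z y0) \<bullet> i) * (G y i b - G y0 i b)) has_derivative (\<lambda>_. 0)) (at y0)" for i
    proof (rule has_derivative_mult_vanishing)
      show "((\<lambda>y. G y i b - G y0 i b) has_derivative frechet_derivative (\<lambda>y. G y i b) (at y0)) (at y0)"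
        using has_derivative_diff[OF frechet_derivative_works[THEN iffD1, OF diff] has_derivative_const, of i b "G y0 i b"]
        by simp
    qed (use cont in \<open>auto intro!: continuous_intros\<close>)
    then show ?thesis by (intro differentiable_sum finite_Basis ballI differentiableI)
  qed
  have eq: "Z y0 + (\<Sum>b\<in>Basis. (G y (Z y) b - G y (Z y0) b - ?rem b y) *\<^sub>R c b) = Z y" if y: "y \<in> S" for y
  proof -
    let ?a = "Z y - Z y0"
    have "G y0 ?a b = G y (Z y) b - G y (Z y0) b - ?rem b y" for b
    proof -
      have "G y (Z y) b - G y (Z y0) b = G y ?a b"
        by (simp add: bilinear_lsub[OF inner_product_bilinear[OF G[OF y]]])
      also have "\<dots> = (\<Sum>i\<in>Basis. (?a \<bullet> i) * G y i b)"
        by (rule inner_product_expand(1)[OF G[OF y]])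
      also have "\<dots> = ?rem b y + (\<Sum>i\<in>Basis. (?a \<bullet> i) * G y0 i b)"
        by (simp add: right_diff_distrib sum_subtractf)
      also have "(\<Sum>i\<in>Basis. (?a \<bullet> i) * G y0 i b) = G y0 ?a b"
        by (rule inner_product_expand(1)[OF G0, symmetric])
      finally show ?thesis by simp
    qed
    then show ?thesis using expand[of ?a] by simp
  qed
  have "(\<lambda>y. Z y0 + (\<Sum>b\<in>Basis. (G y (Z y) b - G y (Z y0) b - ?rem b y) *\<^sub>R c b)) differentiable (at y0)"
    (is "?S differentiable _")
    by (rule differentiable_add[OF differentiable_const differentiable_sum[OF finite_Basis ballI]],
        rule differentiable_scaleR[OF differentiable_diff[OF differentiable_diff[OF rhs diff] rem] differentiable_const])
  then obtain D where D: "(?S has_derivative D) (at y0)"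
    unfolding differentiable_def by (rule exE)
  have "(Z has_derivative D) (at y0)"
    by (rule has_derivative_transform_within_open[OF D S eq])
  then show ?thesis
    by (rule differentiableI)
qed

text \<open>The derivative of \<open>Z\<close> in direction \<open>h\<close> solves a system with the same matrix, whose right-hand
  side \<open>D\<^sub>h (G Z) - (D\<^sub>h G) Z\<close> contains \<open>Z\<close> itself but no derivative of it. This makes an induction
  on the order of differentiability possible.\<close>

lemma Ck_on_solution:
  assumes G: "\<And>y. y \<in> S \<Longrightarrow> inner_product (G y)" and S: "open S"
    and CG: "\<And>a b. Ck_on k S (\<lambda>y. G y a b)"
    and "\<And>b. Ck_on k S (\<lambda>y. G y (Z y) b)"
  shows "Ck_on k S Z"
  using assms(3,4)
proof (induction k arbitrary: Z)
  case 0
  show ?case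
    using solution_continuous[of S G Z, OF G S 0[unfolded Ck_on.simps]] unfolding Ck_on.simps .
next
  case (Suc k)
  let ?D = "\<lambda>h y. frechet_derivative Z (at y) h"
  have Ck: "Ck_on k S Z"
    by (rule Suc.IH[OF Ck_on_SucD'[OF Suc.prems(1)] Ck_on_SucD'[OF Suc.prems(2)]])
  have der: "(Z has_derivative frechet_derivative Z (at y)) (at y)" if "y \<in> S" for y
  proof -
    have "isCont Z y"
      using Ck_on_imp_continuous_on[OF Ck] S that by (simp add: continuous_on_eq_continuous_at)
    then have "Z differentiable (at y)"
      by (intro solution_differentiable[where G = G and S = S]) (use G S Suc.prems that in auto)
    then show ?thesis by (simp add: frechet_derivative_works)
  qed
  show ?case
  proof (rule Ck_on_SucI[OF S der])
    fix h
    have eq: "frechet_derivative (\<lambda>y. G y (Z y) b) (at y) h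
        - (\<Sum>i\<in>Basis. (Z y \<bullet> i) * frechet_derivative (\<lambda>y. G y i b) (at y) h)
        = G y (?D h y) b" if y: "y \<in> S" for y b
    proof -
      have "((\<lambda>y. \<Sum>i\<in>Basis. (Z y \<bullet> i) * G y i b) has_derivative
          (\<lambda>h. \<Sum>i\<in>Basis. (Z y \<bullet> i) * frechet_derivative (\<lambda>y. G y i b) (at y) h + (?D h y \<bullet> i) * G y i b)) (at y)"
        by (intro has_derivative_sum has_derivative_mult has_derivative_inner_left der y
            Ck_on_SucD(1)[OF Suc.prems(1)])
      moreover have "(\<Sum>i\<in>Basis. (Z p \<bullet> i) * G p i b) = G p (Z p) b" if "p \<in> S" for p
        by (rule inner_product_expand(1)[OF G[OF that], symmetric])
      ultimately have "((\<lambda>y. G y (Z y) b) has_derivative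
          (\<lambda>h. \<Sum>i\<in>Basis. (Z y \<bullet> i) * frechet_derivative (\<lambda>y. G y i b) (at y) h + (?D h y \<bullet> i) * G y i b)) (at y)"
        by (rule has_derivative_transform_within_open[OF _ S y])
      from frechet_derivative_eqI[OF this]
      show ?thesis
        using inner_product_expand(1)[OF G[OF y], of "?D h y" b]
        by (simp add: sum.distrib)
    qed
    show "Ck_on k S (?D h)"
    proof (rule Suc.IH)
      fix b
      show "Ck_on k S (\<lambda>y. G y (?D h y) b)"
        by (rule Ck_on_cong[OF _ S eq])
          (intro Ck_on_diff S Ck_on_SucD(2) Suc.prems Ck_on_sum Ck_on_mult Ck_on_bounded_linear[OF bounded_linear_inner_left] Ck)
    qed (rule Ck_on_SucD'[OF Suc.prems(1)])
  qed
qed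

section \<open>Uniqueness for ordinary differential equations\<close>

lemma C1_locally_Lipschitz:
  fixes H :: "'a::euclidean_space \<Rightarrow> 'b::euclidean_space"
  assumes C1: "Ck_on (Suc 0) S H" and S: "open S" "x \<in> S"
  shows "\<exists>r>0. \<exists>K\<ge>0. ball x r \<subseteq> S \<and> (\<forall>p\<in>ball x r. \<forall>q\<in>ball x r. norm (H p - H q) \<le> K * norm (p - q))"
proof -
  obtain r where r: "r > 0" "cball x r \<subseteq> S"
    using open_contains_cball[THEN iffD1, OF S(1)] S(2) by blast
  let ?B = "\<lambda>p. \<Sum>i\<in>Basis. norm (frechet_derivative H (at p) i)"
  have "continuous_on (cball x r) ?B"
    using Ck_on_SucD(2)[OF C1] r(2) by (intro continuous_intros) (auto intro: continuous_on_subset)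
  then have "bdd_above (?B ` cball x r)"
    by (intro bounded_imp_bdd_above compact_imp_bounded compact_continuous_image compact_cball)
  then obtain K where "\<forall>b\<in>?B ` cball x r. b \<le> K"
    unfolding bdd_above_def by (rule exE)
  then have K: "?B p \<le> K" if "p \<in> cball x r" for p
    by (rule bspec[OF _ imageI[OF that]])
  have "onorm (frechet_derivative H (at p)) \<le> K" if p: "p \<in> ball x r" for p
  proof (rule onorm_le)
    fix v
    have "p \<in> S" using p r by auto
    then have lin: "linear (frechet_derivative H (at p))"
      using Ck_on_SucD(1)[OF C1] has_derivative_linear by blast
    have "norm (frechet_derivative H (at p) v) \<le> (\<Sum>i\<in>Basis. norm v * norm (frechet_derivative H (at p) i))"
      by (subst linear_eq_sum_Basis[OF lin])
        (auto intro!: sum_norm_le mult_right_mono simp: Basis_le_norm)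
    also have "\<dots> = ?B p * norm v" by (simp add: sum_distrib_left mult.commute)
    also have "\<dots> \<le> K * norm v" using K[of p] p by (intro mult_right_mono) auto
    finally show "norm (frechet_derivative H (at p) v) \<le> K * norm v" .
  qed
  moreover have "(H has_derivative frechet_derivative H (at p)) (at p within ball x r)" if "p \<in> ball x r" for p
  proof -
    have "p \<in> S" using r(2) that by (auto intro: less_imp_le)
    then show ?thesis by (rule has_derivative_at_withinI[OF Ck_on_SucD(1)[OF C1]])
  qed
  ultimately have "norm (H p - H q) \<le> K * norm (p - q)" if "p \<in> ball x r" "q \<in> ball x r" for p q
    using that by (intro differentiable_bound[OF convex_ball, where f = H])
  moreover have "K \<ge> 0"
    using K[of x] r(1) sum_nonneg[of Basis "\<lambda>i. norm (frechet_derivative H (at x) i)"] by force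
  ultimately show ?thesis
    using r by (intro exI[of _ r] conjI exI[of _ K]) auto
qed

text \<open>While both solutions stay in the region where \<open>H\<close> has Lipschitz constant \<open>K\<close>, the
  function \<open>e\<^sup>-\<^sup>2\<^sup>K\<^sup>s \<bar>X s - Y s\<bar>\<^sup>2\<close> does not increase.\<close>

lemma ode_unique_right:
  fixes H :: "'a::euclidean_space \<Rightarrow> 'a" and X Y :: "real \<Rightarrow> 'a"
  assumes C1: "Ck_on (Suc 0) S H" and S: "open S" "X t \<in> S"
    and eq: "X t = Y t" and d: "d > 0"
    and X: "\<And>s. t \<le> s \<Longrightarrow> s < t + d \<Longrightarrow> (X has_vector_derivative H (X s)) (at s)"
    and Y: "\<And>s. t \<le> s \<Longrightarrow> s < t + d \<Longrightarrow> (Y has_vector_derivative H (Y s)) (at s)"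
  shows "\<exists>e>0. \<forall>s. t \<le> s \<and> s < t + e \<longrightarrow> X s = Y s"
proof -
  obtain r K where r: "r > 0" and K: "\<And>p q. p \<in> ball (X t) r \<Longrightarrow> q \<in> ball (X t) r \<Longrightarrow> norm (H p - H q) \<le> K * norm (p - q)"
    using C1_locally_Lipschitz[OF C1 S] by blast
  have "isCont X t" "isCont Y t"
    using X[of t] Y[of t] d has_vector_derivative_continuous by auto
  then have "\<forall>\<^sub>F s in nhds t. dist (X s) (X t) < r \<and> dist (Y s) (Y t) < r"
    unfolding isCont_def tendsto_at_iff_tendsto_nhds using r by (intro eventually_conj tendstoD) auto
  then obtain e where e: "e > 0" "\<And>s. dist s t < e \<Longrightarrow> X s \<in> ball (X t) r \<and> Y s \<in> ball (X t) r"
    using eq by (auto simp: eventually_nhds_metric dist_commute)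
  define u where "u = (\<lambda>s. exp (- (2 * K * s)) * ((X s - Y s) \<bullet> (X s - Y s)))"
  show ?thesis
  proof (intro exI[of _ "min d e"] conjI allI impI)
    fix s assume s: "t \<le> s \<and> s < t + min d e"
    have der: "\<exists>y. (u has_real_derivative y) (at q) \<and> y \<le> 0" if q: "t \<le> q" "q \<le> s" for q
    proof -
      let ?a = "X q - Y q" and ?b = "H (X q) - H (Y q)"
      have Xq: "(X has_derivative (\<lambda>h. h *\<^sub>R H (X q))) (at q)" and Yq: "(Y has_derivative (\<lambda>h. h *\<^sub>R H (Y q))) (at q)"
        using X[of q] Y[of q] q s by (auto simp: has_vector_derivative_def)
      have "(u has_derivative (\<lambda>h. h * (exp (- (2 * K * q)) * (2 * (?a \<bullet> ?b) - 2 * K * (?a \<bullet> ?a))))) (at q)"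
        unfolding u_def
        by (rule derivative_eq_intros Xq Yq refl | simp add: algebra_simps inner_commute)+
      then have "(u has_real_derivative exp (- (2 * K * q)) * (2 * (?a \<bullet> ?b) - 2 * K * (?a \<bullet> ?a))) (at q)"
        by (simp add: has_field_derivative_def mult_commute_abs)
      moreover have "?a \<bullet> ?b \<le> K * (?a \<bullet> ?a)"
      proof -
        have "?a \<bullet> ?b \<le> norm ?a * norm ?b" by (rule norm_cauchy_schwarz)
        also have "\<dots> \<le> norm ?a * (K * norm ?a)"
          using K e(2)[of q] q s by (intro mult_left_mono) (auto simp: dist_real_def)
        finally show ?thesis by (simp add: dot_square_norm power2_eq_square mult_ac)
      qed
      ultimately show ?thesis by (intro exI conjI) (auto simp: mult_le_0_iff)
    qed
    have "u s \<le> u t"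
      using DERIV_nonpos_imp_nonincreasing[of t s u] der s by blast
    then have "(X s - Y s) \<bullet> (X s - Y s) \<le> 0"
      using eq by (simp add: u_def mult_le_0_iff)
    then have "(X s - Y s) \<bullet> (X s - Y s) = 0"
      using inner_ge_zero[of "X s - Y s"] by linarith
    then show "X s = Y s" by simp
  qed (use d e in auto)
qed

section \<open>Charts and tangent vectors\<close>

lemma chart_inv_map: "is_chart c \<Longrightarrow> p \<in> chart_dom c \<Longrightarrow> chart_inv c (chart_map c p) = p"
  unfolding is_chart_def homeomorphism_def by blast

lemma chart_inv_continuous_on: "is_chart c \<Longrightarrow> continuous_on (chart_im c) (chart_inv c)"
  unfolding is_chart_def homeomorphism_def by blast

lemma chart_open: "is_chart c \<Longrightarrow> open (chart_dom c)" "is_chart c \<Longrightarrow> open (chart_im c)"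
  unfolding is_chart_def by auto

lemma chart_image_eq:
  assumes "is_chart c"
  shows "chart_map c ` (chart_dom c \<inter> N) = chart_im c \<inter> chart_inv c -` N"
  using chart_inv_map[OF assms] by (auto simp: rev_image_eqI)

lemma chart_image_open:
  assumes "is_chart c" "open N"
  shows "open (chart_map c ` (chart_dom c \<inter> N))"
  unfolding chart_image_eq[OF assms(1)]
  by (intro continuous_open_preimage chart_inv_continuous_on chart_open assms)

context
  fixes M :: "('m::{t2_space, second_countable_topology}, 'e::euclidean_space) riem"
  assumes M: "riemannian_manifold M"
begin

lemma atlas_chart: "c \<in> atlas M \<Longrightarrow> is_chart c"
  using M unfolding riemannian_manifold_def by blast

lemma chart_at_atlas: "p \<in> points M \<Longrightarrow> chart_at M p \<in> atlas M"
  and chart_at_dom: "p \<in> points M \<Longrightarrow> p \<in> chart_dom (chart_at M p)"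
  using M unfolding riemannian_manifold_def by blast+

lemma metric_inner_product: "p \<in> points M \<Longrightarrow> inner_product (metric M p)"
  using M unfolding riemannian_manifold_def by blast

lemma gram_Ck: "c \<in> atlas M \<Longrightarrow> Ck_on k (chart_im c) (\<lambda>y. gram M c y v w)"
  using M unfolding riemannian_manifold_def smooth_on_def by blast

lemma transition_Ck:
  "c \<in> atlas M \<Longrightarrow> d \<in> atlas M \<Longrightarrow> Ck_on k (chart_map c ` (chart_dom c \<inter> chart_dom d)) (transition c d)"
  using M unfolding riemannian_manifold_def smooth_on_def by blast

lemma open_points: "open (points M)"
  unfolding points_def using atlas_chart chart_open(1) by blast

lemma chart_dom_points: "c \<in> atlas M \<Longrightarrow> p \<in> chart_dom c \<Longrightarrow> p \<in> points M"
  unfolding points_def by blast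

lemma transition_has_derivative:
  assumes "c \<in> atlas M" "d \<in> atlas M" "p \<in> chart_dom c" "p \<in> chart_dom d"
  shows "(transition c d has_derivative frechet_derivative (transition c d) (at (chart_map c p)))
    (at (chart_map c p))"
  by (rule Ck_on_SucD(1)[OF transition_Ck[OF assms(1,2), of "Suc 0"]]) (use assms in blast)

text \<open>Vector-valued maps are allowed for the sake of the coordinate map of \<open>c\<close> itself, the instance
  which shows that the derivatives of opposite transition maps are inverse to each other.\<close>

lemma change_of_charts:
  fixes \<phi> :: "'m \<Rightarrow> 'b::euclidean_space"
  assumes "c \<in> atlas M" "d \<in> atlas M" "p \<in> chart_dom c" "p \<in> chart_dom d"
    and \<phi>: "(\<phi> \<circ> chart_inv d) differentiable (at (chart_map d p))"
  shows "frechet_derivative (\<phi> \<circ> chart_inv c) (at (chart_map c p)) v =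
    frechet_derivative (\<phi> \<circ> chart_inv d) (at (chart_map d p))
      (frechet_derivative (transition c d) (at (chart_map c p)) v)"
proof -
  note charts = atlas_chart[OF assms(1)] atlas_chart[OF assms(2)]
  have p: "transition c d (chart_map c p) = chart_map d p"
    by (simp add: transition_def chart_inv_map[OF charts(1)] assms)
  have "((\<lambda>y. (\<phi> \<circ> chart_inv d) (transition c d y)) has_derivative
    (\<lambda>v. frechet_derivative (\<phi> \<circ> chart_inv d) (at (chart_map d p))
      (frechet_derivative (transition c d) (at (chart_map c p)) v))) (at (chart_map c p))"
    using has_derivative_compose[OF transition_has_derivative[OF assms(1-4)], of "\<phi> \<circ> chart_inv d"] \<phi>
    by (simp add: p frechet_derivative_works)
  then have "((\<phi> \<circ> chart_inv c) has_derivative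
    (\<lambda>v. frechet_derivative (\<phi> \<circ> chart_inv d) (at (chart_map d p))
      (frechet_derivative (transition c d) (at (chart_map c p)) v))) (at (chart_map c p))"
    by (rule has_derivative_transform_within_open[OF _ chart_image_open[OF charts(1) chart_open(1)[OF charts(2)]]])
      (use assms in \<open>auto simp: transition_def chart_inv_map[OF charts(1)] chart_inv_map[OF charts(2)]\<close>)
  from frechet_derivative_eqI[OF this] show ?thesis by simp
qed

lemma transition_self:
  assumes "c \<in> atlas M" "p \<in> chart_dom c"
  shows "frechet_derivative (transition c c) (at (chart_map c p)) v = v"
proof -
  note chart = atlas_chart[OF assms(1)]
  have "(transition c c has_derivative (\<lambda>v. v)) (at (chart_map c p))"
    by (rule has_derivative_transform_within_open[OF has_derivative_ident chart_open(2)[OF chart]])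
      (use assms in \<open>auto simp: transition_def chart_inv_map[OF chart]\<close>)
  from frechet_derivative_eqI[OF this] show ?thesis by simp
qed

lemma transition_inverse:
  assumes "c \<in> atlas M" "d \<in> atlas M" "p \<in> chart_dom c" "p \<in> chart_dom d"
  shows "frechet_derivative (transition d c) (at (chart_map d p))
      (frechet_derivative (transition c d) (at (chart_map c p)) v) = v"
  using change_of_charts[OF assms differentiableI[OF transition_has_derivative[OF assms(2,1,4,3), unfolded transition_def]], of v]
    transition_self[OF assms(1,3), of v]
  unfolding transition_def by simp

lemma tvec_tcoord:
  assumes "c \<in> atlas M" "p \<in> chart_dom c"
  shows "tvec M c p (tcoord M c p v) = v" "tcoord M c p (tvec M c p a) = a"
proof -
  note p = chart_dom_points[OF assms]
  note d = chart_at_atlas[OF p] chart_at_dom[OF p]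
  show "tvec M c p (tcoord M c p v) = v" "tcoord M c p (tvec M c p a) = a"
    unfolding tvec_def tcoord_def
    using transition_inverse[OF d(1) assms(1) d(2) assms(2)]
      transition_inverse[OF assms(1) d(1) assms(2) d(2)] by auto
qed

lemma tvec_linear:
  assumes "c \<in> atlas M" "p \<in> chart_dom c"
  shows "linear (tvec M c p)"
  using has_derivative_linear[OF transition_has_derivative[OF assms(1) chart_at_atlas assms(2) chart_at_dom]]
    chart_dom_points[OF assms]
  unfolding tvec_def by simp

lemma tvec_chart_at:
  assumes "p \<in> points M"
  shows "tvec M (chart_at M p) p a = a"
  unfolding tvec_def by (rule transition_self[OF chart_at_atlas[OF assms] chart_at_dom[OF assms]])

lemma gram_chart_map:
  assumes "c \<in> atlas M" "p \<in> chart_dom c"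
  shows "gram M c (chart_map c p) a b = metric M p (tvec M c p a) (tvec M c p b)"
  by (simp add: gram_def Let_def chart_inv_map[OF atlas_chart[OF assms(1)] assms(2)])

lemma gram_inner_product:
  assumes c: "c \<in> atlas M" and y: "y \<in> chart_im c"
  shows "inner_product (gram M c y)"
proof -
  obtain p where p: "p \<in> chart_dom c" "y = chart_map c p" using y by blast
  note lin = tvec_linear[OF c p(1)]
  have g: "inner_product (metric M p)"
    using metric_inner_product chart_dom_points[OF c p(1)] by blast
  have "bilinear (\<lambda>a b. metric M p (tvec M c p a) (tvec M c p b))"
    using inner_product_linear[OF g] linear_compose[OF lin]
    unfolding bilinear_def o_def by auto
  moreover have "tvec M c p a \<noteq> 0" if "a \<noteq> 0" for a
    using tvec_tcoord(2)[OF c p(1), of a] tvec_tcoord(2)[OF c p(1), of 0] linear_0[OF lin] that by auto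
  ultimately show ?thesis
    using g unfolding inner_product_def p(2) gram_chart_map[OF c p(1), abs_def] by auto
qed

section \<open>The Levi-Civita connection in a chart\<close>

definition gram_deriv :: "('m, 'e) chart \<Rightarrow> 'e \<Rightarrow> 'e \<Rightarrow> 'e \<Rightarrow> 'e \<Rightarrow> real" where
  "gram_deriv c y h v w = frechet_derivative (\<lambda>p. gram M c p v w) (at y) h"

lemma gram_has_derivative:
  assumes "c \<in> atlas M" "y \<in> chart_im c"
  shows "((\<lambda>p. gram M c p v w) has_derivative (\<lambda>h. gram_deriv c y h v w)) (at y)"
  unfolding gram_deriv_def by (rule Ck_on_SucD(1)[OF gram_Ck[OF assms(1)] assms(2)])

lemma gram_deriv_eqI:
  assumes c: "c \<in> atlas M" and y: "y \<in> chart_im c"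
    and "(g has_derivative g') (at y)" "\<And>q. q \<in> chart_im c \<Longrightarrow> g q = gram M c q v w"
  shows "gram_deriv c y h v w = g' h"
  unfolding gram_deriv_def
  using frechet_derivative_eqI[OF has_derivative_transform_within_open[OF assms(3)
        chart_open(2)[OF atlas_chart[OF c]] y assms(4)]] by simp

lemma gram_deriv_commute:
  assumes "c \<in> atlas M" "y \<in> chart_im c"
  shows "gram_deriv c y h v w = gram_deriv c y h w v"
  by (rule gram_deriv_eqI[OF assms gram_has_derivative[OF assms]])
    (rule inner_product_commute[OF gram_inner_product[OF assms(1)]])

lemma gram_deriv_linear:
  assumes "c \<in> atlas M" "y \<in> chart_im c"
  shows "linear (\<lambda>h. gram_deriv c y h v w)" "linear (\<lambda>v. gram_deriv c y h v w)"
    "linear (\<lambda>w. gram_deriv c y h v w)"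
proof -
  note der = gram_has_derivative[OF assms]
  note bil = inner_product_bilinear[OF gram_inner_product[OF assms(1)]]
  show "linear (\<lambda>h. gram_deriv c y h v w)"
    using der by (rule has_derivative_linear)
  show v: "linear (\<lambda>v. gram_deriv c y h v w)" for w
  proof (rule linearI)
    show "gram_deriv c y h (a + b) w = gram_deriv c y h a w + gram_deriv c y h b w" for a b
      by (rule gram_deriv_eqI[OF assms has_derivative_add[OF der der]]) (simp add: bilinear_ladd[OF bil])
    show "gram_deriv c y h (t *\<^sub>R a) w = t *\<^sub>R gram_deriv c y h a w" for t a
      by (rule gram_deriv_eqI[OF assms has_derivative_scaleR_right[OF der]]) (simp add: bilinear_lmul[OF bil])
  qed
  show "linear (\<lambda>w. gram_deriv c y h v w)"
    using v[of v] by (subst gram_deriv_commute[OF assms])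
qed

text \<open>The right-hand side is linear in \<open>z\<close>, so the definite description in the Christoffel form
  denotes the vector that represents it with respect to the inner product.\<close>

lemma koszul:
  assumes c: "c \<in> atlas M" and y: "y \<in> chart_im c"
  shows "gram M c y (christoffel M c y v w) z =
    (gram_deriv c y v w z + gram_deriv c y w v z - gram_deriv c y z v w) / 2"
proof -
  let ?l = "\<lambda>z. (gram_deriv c y v w z + gram_deriv c y w v z - gram_deriv c y z v w) / 2"
  note lin = gram_deriv_linear[OF c y]
  have "linear ?l"
    by (rule linearI) (simp_all add: linear_add[OF lin(1)] linear_add[OF lin(3)]
        linear_cmul[OF lin(1)] linear_cmul[OF lin(3)] field_simps)
  from theI'[OF inner_product_representation[OF gram_inner_product[OF c y] this]]
  show ?thesis
    unfolding christoffel_def gram_deriv_def by blast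
qed

lemma christoffel_commute:
  assumes "c \<in> atlas M" "y \<in> chart_im c"
  shows "christoffel M c y v w = christoffel M c y w v"
  by (rule inner_product_eqI[OF gram_inner_product[OF assms]])
    (simp add: koszul[OF assms] gram_deriv_commute[OF assms, of _ v w])

lemma christoffel_bilinear:
  assumes "c \<in> atlas M" "y \<in> chart_im c"
  shows "bilinear (christoffel M c y)"
proof -
  note lin = gram_deriv_linear[OF assms]
  note bil = inner_product_bilinear[OF gram_inner_product[OF assms]]
  have l: "linear (\<lambda>v. christoffel M c y v w)" for w
  proof (rule linearI)
    show "christoffel M c y (a + b) w = christoffel M c y a w + christoffel M c y b w" for a b
      by (rule inner_product_eqI[OF gram_inner_product[OF assms]])
        (simp add: koszul[OF assms] bilinear_ladd[OF bil] linear_add[OF lin(1)] linear_add[OF lin(2)] field_simps)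
    show "christoffel M c y (t *\<^sub>R a) w = t *\<^sub>R christoffel M c y a w" for t a
      by (rule inner_product_eqI[OF gram_inner_product[OF assms]])
        (simp add: koszul[OF assms] bilinear_lmul[OF bil] linear_cmul[OF lin(1)] linear_cmul[OF lin(2)] field_simps)
  qed
  moreover have "linear (\<lambda>w. christoffel M c y v w)" for v
    using l[of v] by (subst christoffel_commute[OF assms])
  ultimately show ?thesis by (simp add: bilinear_def)
qed

lemma christoffel_Ck:
  assumes "c \<in> atlas M"
  shows "Ck_on k (chart_im c) (\<lambda>y. christoffel M c y v w)"
proof (rule Ck_on_solution[where G = "gram M c"])
  note op = chart_open(2)[OF atlas_chart[OF assms]]
  show "open (chart_im c)" by (rule op)
  have d: "Ck_on k (chart_im c) (\<lambda>y. gram_deriv c y h a b)" for h a b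
    unfolding gram_deriv_def by (rule Ck_on_SucD(2)[OF gram_Ck[OF assms]])
  have "Ck_on k (chart_im c) (\<lambda>y. (1/2) *\<^sub>R (gram_deriv c y v w z + gram_deriv c y w v z - gram_deriv c y z v w))" for z
    by (intro Ck_on_scaleR Ck_on_const Ck_on_add Ck_on_diff d op)
  then show "Ck_on k (chart_im c) (\<lambda>y. gram M c y (christoffel M c y v w) z)" for z
    by (rule Ck_on_cong[OF _ op]) (simp add: koszul[OF assms])
qed (use gram_inner_product[OF assms] gram_Ck[OF assms] in auto)

text \<open>Smoothness jointly in position and velocity, as the right-hand side of the geodesic equation
  requires.\<close>

lemma christoffel_quadratic_Ck:
  assumes c: "c \<in> atlas M"
  shows "Ck_on k (chart_im c \<times> UNIV) (\<lambda>p. christoffel M c (fst p) (snd p) (snd p))"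
proof -
  have op: "open (chart_im c \<times> (UNIV :: 'e set))"
    using chart_open(2)[OF atlas_chart[OF c]] by (intro open_Times) auto
  have comp: "Ck_on k (chart_im c \<times> UNIV) (\<lambda>p. snd p \<bullet> i)" for i :: 'e
    using Ck_on_linear[OF bounded_linear.linear[OF bounded_linear_inner_left_comp[OF bounded_linear_snd]]] .
  have "Ck_on k (chart_im c \<times> (UNIV :: 'e set)) (\<lambda>p. christoffel M c (fst p) i j)" for i j
    by (rule Ck_on_compose[OF op chart_open(2)[OF atlas_chart[OF c]] _ christoffel_Ck[OF c]
          Ck_on_linear[OF bounded_linear.linear[OF bounded_linear_fst]]]) auto
  then have "Ck_on k (chart_im c \<times> UNIV)
    (\<lambda>p. \<Sum>i\<in>Basis. \<Sum>j\<in>Basis. ((snd p \<bullet> i) * (snd p \<bullet> j)) *\<^sub>R christoffel M c (fst p) i j)"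
    by (intro Ck_on_sum Ck_on_scaleR Ck_on_mult comp op)
  then show ?thesis
    by (rule Ck_on_cong[OF _ op]) (use bilinear_eq_sum_Basis[OF christoffel_bilinear[OF c], symmetric] in auto)
qed

section \<open>The Hessian in a chart\<close>

lemma second_order_at:
  assumes "C2_on_manifold M N \<phi>" "c \<in> atlas M" "p \<in> chart_dom c" "p \<in> N"
  shows "(\<phi> \<circ> chart_inv c) differentiable (at (chart_map c p))"
  using assms unfolding C2_on_manifold_def numeral_2_eq_2 Ck_on.simps by blast

lemma gradient:
  assumes C2: "C2_on_manifold M N \<phi>" and p: "p \<in> N" "p \<in> points M"
  shows "metric M p (gradient M \<phi> p) w = differential M \<phi> p w"
proof -
  have "linear (differential M \<phi> p)"
    unfolding differential_def
    by (rule linear_frechet_derivative[OF second_order_at[OF C2 chart_at_atlas chart_at_dom]]) (use p in auto)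
  from theI'[OF inner_product_representation[OF metric_inner_product[OF p(2)] this]]
  show ?thesis unfolding gradient_def by blast
qed

text \<open>The preferred charts may vary discontinuously with \<open>p\<close>, so the equation that defines the
  gradient is first moved into a fixed chart.\<close>

lemma gram_gradient:
  assumes C2: "C2_on_manifold M N \<phi>" and c: "c \<in> atlas M" and p: "p \<in> chart_dom c" "p \<in> N"
  shows "gram M c (chart_map c p) (tcoord M c p (gradient M \<phi> p)) w =
    frechet_derivative (\<phi> \<circ> chart_inv c) (at (chart_map c p)) w"
proof -
  note pM = chart_dom_points[OF c p(1)]
  note d = chart_at_atlas[OF pM] chart_at_dom[OF pM]
  have "gram M c (chart_map c p) (tcoord M c p (gradient M \<phi> p)) w =
    differential M \<phi> p (tvec M c p w)"
    by (simp add: gram_chart_map[OF c p(1)] tvec_tcoord(1)[OF c p(1)] gradient[OF C2 p(2) pM])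
  also have "\<dots> = frechet_derivative (\<phi> \<circ> chart_inv c) (at (chart_map c p)) w"
    unfolding differential_def tvec_def
    by (rule change_of_charts[OF c d(1) p(1) d(2) second_order_at[OF C2 d p(2)], symmetric])
  finally show ?thesis .
qed

text \<open>The coordinates \<open>Z\<close> of the gradient solve \<open>G Z w = D\<phi> w\<close>, where \<open>G\<close> is the Gram matrix.
  Differentiating this equation in direction \<open>v\<close> gives
  \<open>G (D\<^sub>v Z) w = D\<^sub>v D\<^sub>w \<phi> - (D\<^sub>v G) Z w\<close>, and with the Koszul formula for \<open>\<Gamma> v Z\<close> the terms with
  derivatives of \<open>G\<close> combine to \<open>- G (\<Gamma> v w) Z = - D\<phi> (\<Gamma> v w)\<close>.\<close>

lemma hessian_in_chart:
  assumes x: "x \<in> points M" and N: "open N" "x \<in> N" and C2: "C2_on_manifold M N \<phi>"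
    and c: "c = chart_at M x" and y: "y = chart_map c x"
  shows "hessian M \<phi> x v w =
    frechet_derivative (\<lambda>q. frechet_derivative (\<phi> \<circ> chart_inv c) (at q) w) (at y) v
    - frechet_derivative (\<phi> \<circ> chart_inv c) (at y) (christoffel M c y v w)"
proof -
  have cM: "c \<in> atlas M" and xc: "x \<in> chart_dom c"
    using chart_at_atlas[OF x] chart_at_dom[OF x] by (auto simp: c)
  note chart = atlas_chart[OF cM]
  let ?\<phi> = "\<phi> \<circ> chart_inv c"
  let ?S = "chart_map c ` (chart_dom c \<inter> N)"
  let ?Z = "\<lambda>q. tcoord M c (chart_inv c q) (gradient M \<phi> (chart_inv c q))"
  have S: "open ?S" "y \<in> ?S" "?S \<subseteq> chart_im c"
    using chart_image_open[OF chart N(1)] xc N(2) by (auto simp: y)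
  have yc: "y \<in> chart_im c" using S by blast
  have C2': "Ck_on (Suc (Suc 0)) ?S ?\<phi>"
    using C2 cM unfolding C2_on_manifold_def numeral_2_eq_2 by blast
  have Z: "gram M c q (?Z q) w = frechet_derivative ?\<phi> (at q) w" if "q \<in> ?S" for q w
  proof -
    obtain p where p: "p \<in> chart_dom c" "p \<in> N" "q = chart_map c p" using \<open>q \<in> ?S\<close> by blast
    show ?thesis
      using gram_gradient[OF C2 cM p(1,2)] by (simp add: p(3) chart_inv_map[OF chart p(1)])
  qed
  have "Ck_on (Suc 0) ?S ?Z"
  proof (rule Ck_on_solution[where G = "gram M c"])
    show "Ck_on (Suc 0) ?S (\<lambda>q. gram M c q (?Z q) b)" for b
      by (rule Ck_on_cong[OF Ck_on_SucD(2)[OF C2'] S(1) Z[symmetric]])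
    show "Ck_on (Suc 0) ?S (\<lambda>q. gram M c q a b)" for a b
      by (rule Ck_on_subset[OF gram_Ck[OF cM] S(3)])
    show "inner_product (gram M c q)" if "q \<in> ?S" for q
      using gram_inner_product[OF cM] that S(3) by blast
  qed (rule S(1))
  note Z' = Ck_on_SucD(1)[OF this S(2)]
  let ?DZ = "frechet_derivative ?Z (at y)"
  let ?z = "?Z y"
  have "((\<lambda>q. \<Sum>i\<in>Basis. (?Z q \<bullet> i) * gram M c q i w) has_derivative
      (\<lambda>h. \<Sum>i\<in>Basis. (?z \<bullet> i) * gram_deriv c y h i w + (?DZ h \<bullet> i) * gram M c y i w)) (at y)"
    by (intro has_derivative_sum has_derivative_mult has_derivative_inner_left Z' gram_has_derivative[OF cM yc])
  then have "((\<lambda>q. frechet_derivative ?\<phi> (at q) w) has_derivative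
      (\<lambda>h. \<Sum>i\<in>Basis. (?z \<bullet> i) * gram_deriv c y h i w + (?DZ h \<bullet> i) * gram M c y i w)) (at y)"
  proof (rule has_derivative_transform_within_open[OF _ S(1,2)])
    fix q assume q: "q \<in> ?S"
    then have "inner_product (gram M c q)" using gram_inner_product[OF cM] S(3) by blast
    from inner_product_expand(1)[OF this, of "?Z q" w]
    show "(\<Sum>i\<in>Basis. (?Z q \<bullet> i) * gram M c q i w) = frechet_derivative ?\<phi> (at q) w"
      using Z[OF q] by simp
  qed
  from frechet_derivative_eqI[OF this]
  have "frechet_derivative (\<lambda>q. frechet_derivative ?\<phi> (at q) w) (at y) v =
      (\<Sum>i\<in>Basis. (?z \<bullet> i) * gram_deriv c y v i w) + (\<Sum>i\<in>Basis. (?DZ v \<bullet> i) * gram M c y i w)"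
    by (simp add: sum.distrib)
  also have "\<dots> = gram_deriv c y v ?z w + gram M c y (?DZ v) w"
    using linear_eq_sum_Basis[where L = "\<lambda>u. gram_deriv c y v u w" and a = ?z, OF gram_deriv_linear(2)[OF cM yc]]
      inner_product_expand(1)[OF gram_inner_product[OF cM yc], of "?DZ v" w] by simp
  finally have second: "gram M c y (?DZ v) w =
      frechet_derivative (\<lambda>q. frechet_derivative ?\<phi> (at q) w) (at y) v - gram_deriv c y v ?z w"
    by simp
  have "hessian M \<phi> x v w = gram M c y (?DZ v + christoffel M c y v ?z) w"
    unfolding hessian_def cov_deriv_def Let_def gram_chart_map[OF cM xc, folded y] c[symmetric] y[symmetric]
    by (simp add: c tvec_chart_at[OF x])
  also have "\<dots> = gram M c y (?DZ v) w + gram M c y (christoffel M c y v ?z) w"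
    by (rule bilinear_ladd[OF inner_product_bilinear[OF gram_inner_product[OF cM yc]]])
  also have "\<dots> = frechet_derivative (\<lambda>q. frechet_derivative ?\<phi> (at q) w) (at y) v
      - gram M c y (christoffel M c y v w) ?z"
    unfolding second koszul[OF cM yc]
    using gram_deriv_commute[OF cM yc, of _ ?z w] gram_deriv_commute[OF cM yc, of _ v w]
      gram_deriv_commute[OF cM yc, of _ v ?z] by (simp add: field_simps)
  also have "gram M c y (christoffel M c y v w) ?z = frechet_derivative ?\<phi> (at y) (christoffel M c y v w)"
    using Z[OF S(2)] inner_product_commute[OF gram_inner_product[OF cM yc]] by metis
  finally show ?thesis .
qed

end

section \<open>Geodesics and the exponential map\<close>

lemma geodesicD:
  assumes "geodesic_on M I \<gamma>"
  shows "open I" "is_interval I" "\<And>t. t \<in> I \<Longrightarrow> isCont \<gamma> t" "\<And>t. t \<in> I \<Longrightarrow> \<gamma> t \<in> points M"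
    and "\<And>c t. c \<in> atlas M \<Longrightarrow> t \<in> I \<Longrightarrow> \<gamma> t \<in> chart_dom c \<Longrightarrow>
      ((chart_map c \<circ> \<gamma>) has_vector_derivative vector_derivative (chart_map c \<circ> \<gamma>) (at t)) (at t)"
    and "\<And>c t. c \<in> atlas M \<Longrightarrow> t \<in> I \<Longrightarrow> \<gamma> t \<in> chart_dom c \<Longrightarrow>
      ((\<lambda>s. vector_derivative (chart_map c \<circ> \<gamma>) (at s)) has_vector_derivative
        - christoffel M c (chart_map c (\<gamma> t)) (vector_derivative (chart_map c \<circ> \<gamma>) (at t))
            (vector_derivative (chart_map c \<circ> \<gamma>) (at t))) (at t)"
  using assms unfolding geodesic_on_def Let_def
  by (auto simp: vector_derivative_works[symmetric] continuous_on_eq_continuous_at image_subset_iff)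

lemma is_interval_linear_vimage:
  fixes I :: "real set"
  assumes "is_interval I"
  shows "is_interval {s. t * s \<in> I}"
proof -
  have "{s. t * s \<in> I} = (\<lambda>s. t * s) -` I" by auto
  moreover have "linear (\<lambda>s. t * s :: real)" by (rule linearI) (auto simp: algebra_simps)
  ultimately show ?thesis
    using convex_linear_vimage[of "\<lambda>s. t * s" I] assms by (simp add: is_interval_convex_1)
qed

context
  fixes M :: "('m::{t2_space, second_countable_topology}, 'e::euclidean_space) riem"
  assumes M: "riemannian_manifold M"
begin

text \<open>In a chart the geodesic equation is the first order system \<open>(y, v)' = (v, - \<Gamma>\<^sub>y v v)\<close> for
  position and velocity.\<close>

lemma geodesic_unique_right:
  assumes g: "geodesic_on M I \<gamma>" and h: "geodesic_on M J \<eta>" and t: "t \<in> I" "t \<in> J"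
    and c: "c \<in> atlas M" "\<gamma> t \<in> chart_dom c"
    and eq: "\<gamma> t = \<eta> t"
      "vector_derivative (chart_map c \<circ> \<gamma>) (at t) = vector_derivative (chart_map c \<circ> \<eta>) (at t)"
  shows "\<exists>e>0. \<forall>s. t \<le> s \<and> s < t + e \<longrightarrow> \<gamma> s = \<eta> s"
proof -
  note chart = atlas_chart[OF M c(1)]
  let ?phase = "\<lambda>\<gamma> s. (chart_map c (\<gamma> s), vector_derivative (chart_map c \<circ> \<gamma>) (at s))"
  let ?H = "\<lambda>p. (snd p, - christoffel M c (fst p) (snd p) (snd p))"
  let ?S = "chart_im c \<times> (UNIV :: 'e set)"
  have phase: "(?phase \<gamma> has_vector_derivative ?H (?phase \<gamma> s)) (at s)"
    if "geodesic_on M I \<gamma>" "s \<in> I" "\<gamma> s \<in> chart_dom c" for \<gamma> I s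
    using has_derivative_Pair[OF geodesicD(5)[OF that(1) c(1) that(2,3), unfolded has_vector_derivative_def]
        geodesicD(6)[OF that(1) c(1) that(2,3), unfolded has_vector_derivative_def]]
    by (simp add: has_vector_derivative_def o_def)
  have "\<forall>\<^sub>F s in nhds t. s \<in> I \<and> s \<in> J \<and> \<gamma> s \<in> chart_dom c \<and> \<eta> s \<in> chart_dom c"
  proof -
    have near: "\<forall>\<^sub>F s in nhds t. \<gamma> s \<in> chart_dom c" if "geodesic_on M I \<gamma>" "t \<in> I" "\<gamma> t \<in> chart_dom c" for \<gamma> I
    proof -
      have "(\<gamma> \<longlongrightarrow> \<gamma> t) (nhds t)"
        using geodesicD(3)[OF that(1,2)] unfolding isCont_def by (rule tendsto_at_iff_tendsto_nhds[THEN iffD1])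
      then show ?thesis by (rule topological_tendstoD[OF _ chart_open(1)[OF chart] that(3)])
    qed
    show ?thesis
      using geodesicD(1)[OF g] geodesicD(1)[OF h] t near[OF g t(1) c(2)] near[OF h t(2)] c(2) eq(1)
      by (auto intro!: eventually_conj simp: eventually_nhds_in_open)
  qed
  then obtain d where d: "d > 0" "\<And>s. dist s t < d \<Longrightarrow> s \<in> I \<and> s \<in> J \<and> \<gamma> s \<in> chart_dom c \<and> \<eta> s \<in> chart_dom c"
    by (auto simp: eventually_nhds_metric)
  have S: "open ?S"
    using chart_open(2)[OF chart] by (intro open_Times) auto
  \<comment> \<open>Splitting the pair into two bounded linear images reduces the claim to its Christoffel part.\<close>
  have "Ck_on (Suc 0) ?S (\<lambda>p. (snd p, 0) + (0, - 1 *\<^sub>R christoffel M c (fst p) (snd p) (snd p)))"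
  proof (rule Ck_on_add[OF S])
    have bl: "bounded_linear (\<lambda>p :: 'e \<times> 'e. (snd p, 0) :: 'e \<times> 'e)"
      "bounded_linear (\<lambda>v. (0, - 1 *\<^sub>R v) :: 'e \<times> 'e)"
      by (auto intro!: bounded_linear_intros bounded_linear_minus[OF bounded_linear_ident])
    show "Ck_on (Suc 0) ?S (\<lambda>p. (snd p, 0 :: 'e))"
      by (rule Ck_on_linear[OF bounded_linear.linear[OF bl(1)]])
    show "Ck_on (Suc 0) ?S (\<lambda>p. (0 :: 'e, - 1 *\<^sub>R christoffel M c (fst p) (snd p) (snd p)))"
      by (rule Ck_on_bounded_linear[OF bl(2) S christoffel_quadratic_Ck[OF M c(1)]])
  qed
  then have "Ck_on (Suc 0) ?S ?H"
    by (rule Ck_on_cong[OF _ S]) simp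
  from ode_unique_right[OF this S _ _ d(1), of "?phase \<gamma>" t "?phase \<eta>"]
  obtain e where e: "e > 0" "\<And>s. t \<le> s \<and> s < t + e \<Longrightarrow> ?phase \<gamma> s = ?phase \<eta> s"
    using phase[OF g] phase[OF h] d(2) c(2) eq by (auto simp: dist_real_def)
  show ?thesis
  proof (intro exI[of _ "min e d"] conjI allI impI)
    fix s assume s: "t \<le> s \<and> s < t + min e d"
    then have "chart_map c (\<gamma> s) = chart_map c (\<eta> s)" using e(2)[of s] by auto
    moreover have "\<gamma> s \<in> chart_dom c" "\<eta> s \<in> chart_dom c" using d(2)[of s] s by (auto simp: dist_real_def)
    ultimately show "\<gamma> s = \<eta> s" using chart_inv_map[OF chart] by metis
  qed (use e d in auto)
qed

text \<open>Two geodesics with the same initial data agree on a maximal interval \<open>[0, T]\<close>. By continuity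
  it is closed; at \<open>T > 0\<close> the velocities in any chart agree because they are left derivatives,
  so that local uniqueness would extend the interval if \<open>T < 1\<close>.\<close>

lemma geodesic_unique:
  assumes g: "geodesic_on M I \<gamma>" and h: "geodesic_on M J \<eta>" and I: "{0..1} \<subseteq> I" "{0..1} \<subseteq> J"
    and eq: "\<gamma> 0 = \<eta> 0"
      "vector_derivative (chart_map (chart_at M (\<gamma> 0)) \<circ> \<gamma>) (at 0) =
       vector_derivative (chart_map (chart_at M (\<gamma> 0)) \<circ> \<eta>) (at 0)"
  shows "\<gamma> 1 = \<eta> 1"
proof -
  define A where "A = {t \<in> {0..1}. \<forall>s\<in>{0..t}. \<gamma> s = \<eta> s}"
  define T where "T = Sup A"
  have A: "0 \<in> A" "bdd_above A" using eq(1) by (auto simp: A_def bdd_above_def)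
  have "A \<noteq> {}" using A(1) by blast
  have T0: "0 \<le> T" unfolding T_def by (rule cSup_upper[OF A])
  have T1: "T \<le> 1" unfolding T_def by (rule cSup_least[OF \<open>A \<noteq> {}\<close>]) (simp add: A_def)
  note T = T0 T1
  have below: "\<gamma> s = \<eta> s" if "0 \<le> s" "s < T" for s
  proof -
    obtain t where "t \<in> A" "s < t"
      using \<open>s < T\<close> less_cSup_iff[OF \<open>A \<noteq> {}\<close> A(2), of s] unfolding T_def by blast
    then show ?thesis using \<open>0 \<le> s\<close> by (auto simp: A_def)
  qed
  have TI: "T \<in> I" "T \<in> J" using T I by auto
  have at_T: "\<gamma> T = \<eta> T"
  proof (cases "T = 0")
    case False
    have "(\<gamma> \<longlongrightarrow> \<gamma> T) (at_left T)" "(\<eta> \<longlongrightarrow> \<eta> T) (at_left T)"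
      using geodesicD(3)[OF g TI(1)] geodesicD(3)[OF h TI(2)]
      unfolding isCont_def filterlim_at_split by blast+
    moreover have "\<forall>\<^sub>F s in at_left T. \<gamma> s = \<eta> s"
      using below False T(1) by (intro eventually_at_leftI[of 0]) auto
    then have "((\<lambda>s. \<gamma> s) \<longlongrightarrow> \<eta> T) (at_left T)"
      using calculation(2) tendsto_cong by fast
    ultimately show ?thesis using tendsto_unique[OF trivial_limit_at_left_real] by blast
  qed (use eq in simp)
  have upto: "\<gamma> s = \<eta> s" if "0 \<le> s" "s \<le> T" for s
    using below at_T that by (cases "s = T") auto
  obtain c where c: "c \<in> atlas M" "\<gamma> T \<in> chart_dom c" and
    vel: "vector_derivative (chart_map c \<circ> \<gamma>) (at T) = vector_derivative (chart_map c \<circ> \<eta>) (at T)"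
  proof (cases "T = 0")
    case True
    have "\<gamma> 0 \<in> points M" by (rule geodesicD(4)[OF g subsetD[OF I(1)]]) simp
    then show ?thesis
      using that[of "chart_at M (\<gamma> 0)"] chart_at_atlas[OF M] chart_at_dom[OF M] eq(2) True by simp
  next
    case False
    let ?c = "chart_at M (\<gamma> T)"
    have c: "?c \<in> atlas M" "\<gamma> T \<in> chart_dom ?c"
      using chart_at_atlas[OF M] chart_at_dom[OF M] geodesicD(4)[OF g TI(1)] by auto
    have "((chart_map ?c \<circ> \<eta>) has_vector_derivative vector_derivative (chart_map ?c \<circ> \<eta>) (at T)) (at T within {0..T})"
      using geodesicD(5)[OF h c(1) TI(2)] c(2) at_T by (auto intro: has_vector_derivative_at_within)
    then have "((chart_map ?c \<circ> \<gamma>) has_vector_derivative vector_derivative (chart_map ?c \<circ> \<eta>) (at T)) (at T within {0..T})"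
      by (rule has_vector_derivative_transform[rotated 2]) (use T upto in auto)
    moreover have "((chart_map ?c \<circ> \<gamma>) has_vector_derivative vector_derivative (chart_map ?c \<circ> \<gamma>) (at T)) (at T within {0..T})"
      using geodesicD(5)[OF g c(1) TI(1) c(2)] by (rule has_vector_derivative_at_within)
    ultimately show ?thesis
      using that[OF c] vector_derivative_unique_within_closed_interval[of 0 T T] False T(1) by auto
  qed
  obtain e where e: "e > 0" "\<And>s. T \<le> s \<and> s < T + e \<Longrightarrow> \<gamma> s = \<eta> s"
    using geodesic_unique_right[OF g h TI c at_T vel] by blast
  have "T = 1"
  proof (rule ccontr)
    assume "T \<noteq> 1"
    have "\<gamma> s = \<eta> s" if "0 \<le> s" "s \<le> T + e / 2" for s
      using upto[of s] e(2)[of s] e(1) that by (cases "s \<le> T") auto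
    then have "min 1 (T + e / 2) \<in> A"
      using T e(1) by (auto simp: A_def)
    then have "min 1 (T + e / 2) \<le> T" unfolding T_def by (rule cSup_upper[OF _ A(2)])
    then show False using T e(1) \<open>T \<noteq> 1\<close> by auto
  qed
  then show ?thesis using at_T by simp
qed

lemma geodesic_rescale:
  assumes g: "geodesic_on M I \<gamma>"
  shows "geodesic_on M {s. t * s \<in> I} (\<lambda>s. \<gamma> (t * s))"
    and "\<And>c s. c \<in> atlas M \<Longrightarrow> t * s \<in> I \<Longrightarrow> \<gamma> (t * s) \<in> chart_dom c \<Longrightarrow>
      ((chart_map c \<circ> (\<lambda>s. \<gamma> (t * s))) has_vector_derivative
        t *\<^sub>R vector_derivative (chart_map c \<circ> \<gamma>) (at (t * s))) (at s)"
proof -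
  let ?I = "{s. t * s \<in> I}" and ?\<gamma> = "\<lambda>s. \<gamma> (t * s)"
  note gd = geodesicD[OF g]
  have scale: "((\<lambda>s. t * s) has_vector_derivative t) (at s)" for s :: real
    by (auto intro!: derivative_eq_intros simp: has_vector_derivative_def)
  show vel: "((chart_map c \<circ> ?\<gamma>) has_vector_derivative
        t *\<^sub>R vector_derivative (chart_map c \<circ> \<gamma>) (at (t * s))) (at s)"
    if "c \<in> atlas M" "t * s \<in> I" "\<gamma> (t * s) \<in> chart_dom c" for c s
    using vector_diff_chain_at[OF scale gd(5)[OF that]] by (simp add: o_def)
  have open_I: "open ?I"
    using open_vimage[OF gd(1), of "\<lambda>s. t * s"] by (simp add: vimage_def continuous_on_mult_left)
  show "geodesic_on M ?I ?\<gamma>"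
    unfolding geodesic_on_def Let_def
  proof (intro conjI ballI impI)
    show "is_interval ?I" by (rule is_interval_linear_vimage[OF gd(2)])
    have "isCont ?\<gamma> s" if "s \<in> ?I" for s
    proof (rule isCont_o2[where g = \<gamma> and f = "\<lambda>s. t * s"])
      show "isCont (\<lambda>s. t * s) s" by (intro continuous_intros)
      show "isCont \<gamma> (t * s)" using that gd(3) by simp
    qed
    then show "continuous_on ?I ?\<gamma>" by (simp add: continuous_at_imp_continuous_on)
    show "?\<gamma> ` ?I \<subseteq> points M" using gd(4) by auto
    fix c s assume c: "c \<in> atlas M" and s: "s \<in> ?I" and dom: "\<gamma> (t * s) \<in> chart_dom c"
    have s': "t * s \<in> I" using s by simp
    note bil = christoffel_bilinear[OF M c, of "chart_map c (\<gamma> (t * s))"]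
    show "chart_map c \<circ> ?\<gamma> differentiable at s"
      using vel[OF c s' dom] by (rule differentiableI_vector)
    let ?V = "{s \<in> ?I. ?\<gamma> s \<in> chart_dom c}"
    have "open ?V"
    proof -
      have "?V = ?I \<inter> ?\<gamma> -` chart_dom c" by auto
      then show ?thesis
        using continuous_open_preimage[OF \<open>continuous_on ?I ?\<gamma>\<close> open_I chart_open(1)[OF atlas_chart[OF M c]]] by simp
    qed
    have veq: "vector_derivative (chart_map c \<circ> ?\<gamma>) (at q) = t *\<^sub>R vector_derivative (chart_map c \<circ> \<gamma>) (at (t * q))"
      if "q \<in> ?V" for q
      by (rule vector_derivative_at[OF vel[OF c]]) (use that in auto)
    have "((\<lambda>s. t *\<^sub>R vector_derivative (chart_map c \<circ> \<gamma>) (at (t * s))) has_vector_derivative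
        t *\<^sub>R t *\<^sub>R - christoffel M c (chart_map c (\<gamma> (t * s))) (vector_derivative (chart_map c \<circ> \<gamma>) (at (t * s)))
            (vector_derivative (chart_map c \<circ> \<gamma>) (at (t * s)))) (at s)"
      using has_vector_derivative_scaleR[OF DERIV_const[of t] vector_diff_chain_at[OF scale gd(6)[OF c s' dom]]]
      by (simp add: o_def)
    then have "((\<lambda>s. vector_derivative (chart_map c \<circ> ?\<gamma>) (at s)) has_vector_derivative
        t *\<^sub>R t *\<^sub>R - christoffel M c (chart_map c (\<gamma> (t * s))) (vector_derivative (chart_map c \<circ> \<gamma>) (at (t * s)))
            (vector_derivative (chart_map c \<circ> \<gamma>) (at (t * s)))) (at s)"
      by (rule has_vector_derivative_transform_within_open[OF _ \<open>open ?V\<close> _ veq[symmetric]])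
        (use s dom in auto)
    then show "((\<lambda>s. vector_derivative (chart_map c \<circ> ?\<gamma>) (at s)) has_vector_derivative
       - christoffel M c (chart_map c (?\<gamma> s)) (vector_derivative (chart_map c \<circ> ?\<gamma>) (at s))
           (vector_derivative (chart_map c \<circ> ?\<gamma>) (at s))) (at s)"
      using dom s' by (simp add: veq bilinear_lmul[OF bil] bilinear_rmul[OF bil])
  qed (rule open_I)
qed

text \<open>Uniqueness of geodesics is what makes the definite description of the exponential map
  denote.\<close>

lemma exp_map_eqI:
  assumes "exp_rel M x v p"
  shows "exp_map M x v = p"
  unfolding exp_map_def
proof (rule the_equality[where P = "exp_rel M x v"])
  fix q assume "exp_rel M x v q"
  then obtain J \<eta> where h: "geodesic_on M J \<eta>" "{0..1} \<subseteq> J" "\<eta> 0 = x"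
    "vector_derivative (chart_map (chart_at M x) \<circ> \<eta>) (at 0) = v" "\<eta> 1 = q"
    unfolding exp_rel_def by blast
  obtain I \<gamma> where g: "geodesic_on M I \<gamma>" "{0..1} \<subseteq> I" "\<gamma> 0 = x"
    "vector_derivative (chart_map (chart_at M x) \<circ> \<gamma>) (at 0) = v" "\<gamma> 1 = p"
    using assms unfolding exp_rel_def by blast
  show "q = p"
    using geodesic_unique[OF g(1) h(1) g(2) h(2)] g h by simp
qed (rule assms)

text \<open>Since \<open>s \<mapsto> \<gamma> (t s)\<close> is the geodesic with initial velocity \<open>t v\<close>, the exponential map
  sends the line \<open>t \<mapsto> t v\<close> to the geodesic \<open>\<gamma>\<close>.\<close>

lemma exp_map_along_ray:
  assumes x: "x \<in> points M" and v: "v \<in> exp_domain M x"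
  shows "\<exists>I \<gamma>. geodesic_on M I \<gamma> \<and> 0 \<in> I \<and> \<gamma> 0 = x \<and>
    vector_derivative (chart_map (chart_at M x) \<circ> \<gamma>) (at 0) = v \<and>
    (\<forall>t\<in>I. exp_map M x (t *\<^sub>R v) = \<gamma> t)"
proof -
  obtain I \<gamma> where g: "geodesic_on M I \<gamma>" "{0..1} \<subseteq> I" "\<gamma> 0 = x"
    and vel: "vector_derivative (chart_map (chart_at M x) \<circ> \<gamma>) (at 0) = v"
    using v unfolding exp_domain_def exp_rel_def by blast
  have I0: "0 \<in> I" using g(2) by auto
  have "exp_map M x (t *\<^sub>R v) = \<gamma> t" if t: "t \<in> I" for t
  proof (rule exp_map_eqI)
    have "t * s \<in> I" if "s \<in> {0..1}" for s
    proof -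
      have "convex I" using geodesicD(2)[OF g(1)] is_interval_convex by blast
      from convexD_alt[OF this I0 t, of s] that show ?thesis by (simp add: mult.commute)
    qed
    moreover have "vector_derivative (chart_map (chart_at M x) \<circ> (\<lambda>s. \<gamma> (t * s))) (at 0) = t *\<^sub>R v"
      using vector_derivative_at[OF geodesic_rescale(2)[OF g(1) chart_at_atlas[OF M x], of t 0]]
        I0 g(3) chart_at_dom[OF M x] vel by simp
    ultimately show "exp_rel M x (t *\<^sub>R v) (\<gamma> t)"
      unfolding exp_rel_def
      by (intro exI[of _ "{s. t * s \<in> I}"] exI[of _ "\<lambda>s. \<gamma> (t * s)"]) (auto simp: geodesic_rescale(1)[OF g(1)] g(3))
  qed
  then show ?thesis using g(1,3) I0 vel by blast
qed

end

section \<open>Second derivatives\<close>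

lemma frechet_derivative_cong:
  assumes "open S" "x \<in> S" "\<And>q. q \<in> S \<Longrightarrow> f q = g q"
  shows "frechet_derivative f (at x) = frechet_derivative g (at x)"
proof -
  have "(f has_derivative D) (at x) \<longleftrightarrow> (g has_derivative D) (at x)" for D
    using has_derivative_transform_within_open[OF _ assms(1,2), of f D UNIV g]
      has_derivative_transform_within_open[OF _ assms(1,2), of g D UNIV f] assms(3) by auto
  then show ?thesis unfolding frechet_derivative_def by simp
qed

lemma second_derivative_cong:
  assumes S: "open S" "x \<in> S" and eq: "\<And>q. q \<in> S \<Longrightarrow> f q = g q"
  shows "frechet_derivative (\<lambda>p. frechet_derivative f (at p) v) (at x) =
    frechet_derivative (\<lambda>p. frechet_derivative g (at p) v) (at x)"
  by (rule frechet_derivative_cong[OF S]) (simp add: frechet_derivative_cong[OF S(1) _ eq])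

lemma second_derivative_bilinear:
  assumes C2: "Ck_on 2 S f" and S: "open S" "x \<in> S"
  shows "bilinear (\<lambda>v w. frechet_derivative (\<lambda>p. frechet_derivative f (at p) v) (at x) w)"
proof -
  have C2': "Ck_on (Suc (Suc 0)) S f" using C2 by (simp add: numeral_2_eq_2)
  let ?D = "\<lambda>v p. frechet_derivative f (at p) v"
  have lin: "linear (\<lambda>v. ?D v p)" if "p \<in> S" for p
    using has_derivative_linear[OF Ck_on_SucD(1)[OF C2' that]] .
  note der = Ck_on_SucD(1)[OF Ck_on_SucD(2)[OF C2'] S(2)]
  have "linear (\<lambda>v. frechet_derivative (?D v) (at x) w)" for w
  proof (rule linearI)
    fix a b
    have "(?D (a + b) has_derivative (\<lambda>w. frechet_derivative (?D a) (at x) w + frechet_derivative (?D b) (at x) w)) (at x)"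
      by (rule has_derivative_transform_within_open[OF has_derivative_add[OF der der] S])
        (simp add: linear_add[OF lin])
    from frechet_derivative_eqI[OF this]
    show "frechet_derivative (?D (a + b)) (at x) w = frechet_derivative (?D a) (at x) w + frechet_derivative (?D b) (at x) w"
      by simp
  next
    fix t a
    have "(?D (t *\<^sub>R a) has_derivative (\<lambda>w. t *\<^sub>R frechet_derivative (?D a) (at x) w)) (at x)"
      by (rule has_derivative_transform_within_open[OF has_derivative_scaleR_right[OF der] S])
        (simp add: linear_cmul[OF lin])
    from frechet_derivative_eqI[OF this]
    show "frechet_derivative (?D (t *\<^sub>R a)) (at x) w = t *\<^sub>R frechet_derivative (?D a) (at x) w"
      by simp
  qed
  then show ?thesis
    using has_derivative_linear[OF der] by (simp add: bilinear_def)
qed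

lemma derivative_compose:
  fixes g :: "'b::euclidean_space \<Rightarrow> 'c::euclidean_space" and h :: "'a::euclidean_space \<Rightarrow> 'b"
  assumes g: "Ck_on (Suc k) T g" and h: "Ck_on (Suc k) S h" and "h ` S \<subseteq> T" and x: "x \<in> S"
  shows "frechet_derivative (\<lambda>p. g (h p)) (at x) v =
    frechet_derivative g (at (h x)) (frechet_derivative h (at x) v)"
proof -
  have "h x \<in> T" using assms by blast
  from frechet_derivative_eqI[OF has_derivative_compose[OF Ck_on_SucD(1)[OF h x] Ck_on_SucD(1)[OF g this]]]
  show ?thesis by simp
qed

text \<open>The chain rule is applied to the expansion \<open>D(g \<circ> h) w = (\<Sum>i. (Dh w \<bullet> i) *\<^sub>R (D\<^sub>i g \<circ> h))\<close>,
  whose terms are products of differentiable functions; bilinearity of \<open>D\<^sup>2g\<close> collects the sums.\<close>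

lemma second_derivative_compose:
  fixes g :: "'b::euclidean_space \<Rightarrow> 'c::euclidean_space" and h :: "'a::euclidean_space \<Rightarrow> 'b"
  assumes g: "Ck_on 2 T g" and h: "Ck_on 2 S h" and op: "open S" "open T"
    and sub: "h ` S \<subseteq> T" and x: "x \<in> S"
  shows "frechet_derivative (\<lambda>p. frechet_derivative (\<lambda>p. g (h p)) (at p) w) (at x) v =
    frechet_derivative (\<lambda>q. frechet_derivative g (at q) (frechet_derivative h (at x) w)) (at (h x))
      (frechet_derivative h (at x) v)
    + frechet_derivative g (at (h x)) (frechet_derivative (\<lambda>p. frechet_derivative h (at p) w) (at x) v)"
proof -
  have g2: "Ck_on (Suc (Suc 0)) T g" and h2: "Ck_on (Suc (Suc 0)) S h"
    using g h by (simp_all add: numeral_2_eq_2)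
  have hx: "h x \<in> T" using sub x by blast
  let ?Dg = "\<lambda>v p. frechet_derivative g (at p) v"
  let ?Dh = "\<lambda>v p. frechet_derivative h (at p) v"
  have lin_g: "linear (frechet_derivative g (at q))" if "q \<in> T" for q
    using has_derivative_linear[OF Ck_on_SucD(1)[OF g2 that]] .
  have expand: "?Dg a q = (\<Sum>i\<in>Basis. (a \<bullet> i) *\<^sub>R ?Dg i q)" if "q \<in> T" for a q
    by (rule linear_eq_sum_Basis[OF lin_g[OF that]])
  have DDg: "((\<lambda>p. ?Dg i (h p)) has_derivative (\<lambda>v. frechet_derivative (?Dg i) (at (h x)) (?Dh v x))) (at x)" for i
    by (rule has_derivative_compose[OF Ck_on_SucD(1)[OF h2 x] Ck_on_SucD(1)[OF Ck_on_SucD(2)[OF g2] hx]])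
  have "((\<lambda>p. \<Sum>i\<in>Basis. (?Dh w p \<bullet> i) *\<^sub>R ?Dg i (h p)) has_derivative
      (\<lambda>v. \<Sum>i\<in>Basis. (?Dh w x \<bullet> i) *\<^sub>R frechet_derivative (?Dg i) (at (h x)) (?Dh v x)
        + (frechet_derivative (?Dh w) (at x) v \<bullet> i) *\<^sub>R ?Dg i (h x))) (at x)"
    by (intro has_derivative_sum has_derivative_scaleR DDg has_derivative_inner_left
        Ck_on_SucD(1)[OF Ck_on_SucD(2)[OF h2] x])
  then have "((\<lambda>p. frechet_derivative (\<lambda>p. g (h p)) (at p) w) has_derivative
      (\<lambda>v. \<Sum>i\<in>Basis. (?Dh w x \<bullet> i) *\<^sub>R frechet_derivative (?Dg i) (at (h x)) (?Dh v x)
        + (frechet_derivative (?Dh w) (at x) v \<bullet> i) *\<^sub>R ?Dg i (h x))) (at x)"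
  proof (rule has_derivative_transform_within_open[OF _ op(1) x])
    fix p assume p: "p \<in> S"
    then have "h p \<in> T" using sub by blast
    then show "(\<Sum>i\<in>Basis. (?Dh w p \<bullet> i) *\<^sub>R ?Dg i (h p)) = frechet_derivative (\<lambda>p. g (h p)) (at p) w"
      using expand[of "h p" "?Dh w p"] derivative_compose[OF g2 h2 sub p] by simp
  qed
  from frechet_derivative_eqI[OF this]
  have "frechet_derivative (\<lambda>p. frechet_derivative (\<lambda>p. g (h p)) (at p) w) (at x) v =
    (\<Sum>i\<in>Basis. (?Dh w x \<bullet> i) *\<^sub>R frechet_derivative (?Dg i) (at (h x)) (?Dh v x))
    + (\<Sum>i\<in>Basis. (frechet_derivative (?Dh w) (at x) v \<bullet> i) *\<^sub>R ?Dg i (h x))"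
    by (simp add: sum.distrib)
  moreover have "linear (\<lambda>a. frechet_derivative (?Dg a) (at (h x)) (?Dh v x))"
    using second_derivative_bilinear[OF g op(2) hx] by (simp add: bilinear_def)
  from linear_eq_sum_Basis[OF this, of "?Dh w x"]
  have "(\<Sum>i\<in>Basis. (?Dh w x \<bullet> i) *\<^sub>R frechet_derivative (?Dg i) (at (h x)) (?Dh v x)) =
    frechet_derivative (?Dg (?Dh w x)) (at (h x)) (?Dh v x)" by simp
  ultimately show ?thesis
    using expand[OF hx, of "frechet_derivative (?Dh w) (at x) v"] by simp
qed

lemma bilinear_polarization:
  assumes "bilinear A" "bilinear B" and sym: "\<And>v w. A v w = A w v" "\<And>v w. B v w = B w v"
    and diag: "\<And>v. A v v = B v v"
  shows "A v w = B v w"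
proof -
  have "A (v + w) (v + w) = A v v + A w w + 2 *\<^sub>R A v w"
    using sym(1)[of w v] by (simp add: bilinear_ladd[OF assms(1)] bilinear_radd[OF assms(1)] scaleR_2)
  moreover have "B (v + w) (v + w) = B v v + B w w + 2 *\<^sub>R B v w"
    using sym(2)[of w v] by (simp add: bilinear_ladd[OF assms(2)] bilinear_radd[OF assms(2)] scaleR_2)
  ultimately have "2 *\<^sub>R A v w = 2 *\<^sub>R B v w" using diag by (metis add_left_cancel)
  then show ?thesis by simp
qed

section \<open>The exponential map to second order\<close>

lemma exp_map_zero:
  assumes M: "riemannian_manifold M" and x: "x \<in> points M" and v: "v \<in> exp_domain M x"
  shows "exp_map M x 0 = x"
  using exp_map_along_ray[OF M x v] by (metis scaleR_zero_left)

text \<open>Along the ray \<open>t \<mapsto> t v\<close> the coordinates of the exponential map are those of the geodesic with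
  initial velocity \<open>v\<close>. Its velocity and acceleration at \<open>0\<close> are \<open>DE(0) v\<close> and \<open>D\<^sup>2E(0) v v\<close>,
  and the geodesic equation gives the acceleration.\<close>

lemma exp_map_second_order_ray:
  assumes M: "riemannian_manifold M" and x: "x \<in> points M" and v: "v \<in> exp_domain M x"
    and c: "c = chart_at M x" and E: "E = chart_map c \<circ> exp_map M x"
    and W: "open W" "0 \<in> W" "\<And>u. u \<in> W \<Longrightarrow> exp_map M x u \<in> chart_dom c"
    and C2: "Ck_on 2 W E"
  shows "frechet_derivative E (at 0) v = v"
    and "frechet_derivative (\<lambda>p. frechet_derivative E (at p) v) (at 0) v =
      - christoffel M c (chart_map c x) v v"
proof -
  have C2': "Ck_on (Suc (Suc 0)) W E" using C2 by (simp add: numeral_2_eq_2)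
  have cM: "c \<in> atlas M" and xc: "x \<in> chart_dom c"
    using chart_at_atlas[OF M x] chart_at_dom[OF M x] by (auto simp: c)
  obtain I \<gamma> where g: "geodesic_on M I \<gamma>" "0 \<in> I" "\<gamma> 0 = x"
    and vel: "vector_derivative (chart_map c \<circ> \<gamma>) (at 0) = v"
    and ray: "\<And>t. t \<in> I \<Longrightarrow> exp_map M x (t *\<^sub>R v) = \<gamma> t"
    using exp_map_along_ray[OF M x v] unfolding c by blast
  let ?V = "I \<inter> (\<lambda>t. t *\<^sub>R v) -` W"
  have V: "open ?V" "0 \<in> ?V"
    using geodesicD(1)[OF g(1)] g(2) W by (auto intro!: open_Int open_vimage continuous_intros)
  have line: "((\<lambda>t. t *\<^sub>R v) has_derivative (\<lambda>h. h *\<^sub>R v)) (at t)" for t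
    by (auto intro!: derivative_eq_intros)
  have along: "((\<lambda>t. H (t *\<^sub>R v)) has_vector_derivative frechet_derivative H (at (t *\<^sub>R v)) v) (at t)"
    if "(H has_derivative frechet_derivative H (at (t *\<^sub>R v))) (at (t *\<^sub>R v))" for H :: "'b \<Rightarrow> 'b" and t
    using has_derivative_compose[OF line that] linear_cmul[OF has_derivative_linear[OF that]]
    by (simp add: has_vector_derivative_def)
  have vel_eq: "vector_derivative (chart_map c \<circ> \<gamma>) (at t) = frechet_derivative E (at (t *\<^sub>R v)) v"
    if t: "t \<in> ?V" for t
  proof (rule vector_derivative_at)
    have "t *\<^sub>R v \<in> W" using t by simp
    from along[OF Ck_on_SucD(1)[OF C2' this]]
    show "((chart_map c \<circ> \<gamma>) has_vector_derivative frechet_derivative E (at (t *\<^sub>R v)) v) (at t)"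
      by (rule has_vector_derivative_transform_within_open[OF _ V(1) t]) (simp add: E ray)
  qed
  show "frechet_derivative E (at 0) v = v"
    using vel_eq[OF V(2)] vel by simp
  have "((\<lambda>t. frechet_derivative E (at (t *\<^sub>R v)) v) has_vector_derivative
      frechet_derivative (\<lambda>p. frechet_derivative E (at p) v) (at 0) v) (at 0)"
    using along[OF Ck_on_SucD(1)[OF Ck_on_SucD(2)[OF C2']], of 0] W(2) by simp
  then have "((\<lambda>t. vector_derivative (chart_map c \<circ> \<gamma>) (at t)) has_vector_derivative
      frechet_derivative (\<lambda>p. frechet_derivative E (at p) v) (at 0) v) (at 0)"
    by (rule has_vector_derivative_transform_within_open[OF _ V]) (simp add: vel_eq)
  moreover have "((\<lambda>t. vector_derivative (chart_map c \<circ> \<gamma>) (at t)) has_vector_derivative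
      - christoffel M c (chart_map c x) v v) (at 0)"
    using geodesicD(6)[OF g(1) cM g(2)] xc by (simp add: g(3) vel)
  ultimately show "frechet_derivative (\<lambda>p. frechet_derivative E (at p) v) (at 0) v =
      - christoffel M c (chart_map c x) v v"
    by (rule vector_derivative_unique_at)
qed

text \<open>Both sides of the two identities are homogeneous in \<open>v\<close>, so they extend from a neighbourhood
  of the origin to all tangent vectors; the second one is then polarized.\<close>

lemma exp_map_second_order:
  assumes M: "riemannian_manifold M" and x: "x \<in> points M"
    and U: "open U" "0 \<in> U" "U \<subseteq> exp_domain M x"
    and c: "c = chart_at M x" and E: "E = chart_map c \<circ> exp_map M x"
    and W: "open W" "0 \<in> W" "\<And>u. u \<in> W \<Longrightarrow> exp_map M x u \<in> chart_dom c"
    and C2: "Ck_on 2 W E"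
  shows "frechet_derivative E (at 0) v = v"
    and "frechet_derivative (\<lambda>p. frechet_derivative E (at p) v) (at 0) w =
      - christoffel M c (chart_map c x) v w"
proof -
  have C2': "Ck_on (Suc (Suc 0)) W E" using C2 by (simp add: numeral_2_eq_2)
  have cM: "c \<in> atlas M" and yc: "chart_map c x \<in> chart_im c"
    using chart_at_atlas[OF M x] chart_at_dom[OF M x] by (auto simp: c)
  let ?B = "\<lambda>v w. frechet_derivative (\<lambda>p. frechet_derivative E (at p) v) (at 0) w"
  let ?\<Gamma> = "christoffel M c (chart_map c x)"
  note bil_B = second_derivative_bilinear[OF C2 W(1,2)]
  note bil_\<Gamma> = christoffel_bilinear[OF M cM yc]
  have small: "\<exists>e>0. e *\<^sub>R v \<in> exp_domain M x" for v
  proof -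
    have "open ((\<lambda>e. e *\<^sub>R v) -` U)" "0 \<in> (\<lambda>e. e *\<^sub>R v) -` U"
      using U by (auto intro!: open_vimage continuous_intros)
    then obtain d where "d > 0" "cball 0 d \<subseteq> (\<lambda>e. e *\<^sub>R v) -` U"
      using open_contains_cball by blast
    then show ?thesis using U(3) by (intro exI[of _ d]) (auto simp: subset_iff)
  qed
  show "frechet_derivative E (at 0) v = v"
  proof -
    obtain e where e: "e > 0" "e *\<^sub>R v \<in> exp_domain M x" using small by blast
    from exp_map_second_order_ray(1)[OF M x e(2) c E W C2]
    show ?thesis
      using e(1) linear_cmul[OF has_derivative_linear[OF Ck_on_SucD(1)[OF C2' W(2)]]] by simp
  qed
  have diag: "?B v v = - ?\<Gamma> v v" for v
  proof -
    obtain e where e: "e > 0" "e *\<^sub>R v \<in> exp_domain M x" using small by blast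
    have "(e * e) *\<^sub>R ?B v v = ?B (e *\<^sub>R v) (e *\<^sub>R v)"
      by (simp add: bilinear_lmul[OF bil_B] bilinear_rmul[OF bil_B])
    also have "\<dots> = - ?\<Gamma> (e *\<^sub>R v) (e *\<^sub>R v)"
      by (rule exp_map_second_order_ray(2)[OF M x e(2) c E W C2])
    also have "\<dots> = (e * e) *\<^sub>R (- ?\<Gamma> v v)"
      by (simp add: bilinear_lmul[OF bil_\<Gamma>] bilinear_rmul[OF bil_\<Gamma>])
    finally show ?thesis using e(1) by (simp only: scaleR_cancel_left) simp
  qed
  have neg: "bilinear (\<lambda>v w. - ?\<Gamma> v w)"
    using bil_\<Gamma> by (simp add: bilinear_def linear_compose_neg)
  show "?B v w = - ?\<Gamma> v w"
    by (rule bilinear_polarization[OF bil_B neg second_derivative_symmetric[OF C2 W(1,2)] _ diag])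
      (simp add: christoffel_commute[OF M cM yc])
qed

section \<open>A neighbourhood of the origin of the tangent space\<close>

abbreviation tangent_nbhd ::
  "('m, 'e::euclidean_space) riem \<Rightarrow> 'm \<Rightarrow> 'e set \<Rightarrow> ('e, 'e) riem" where
  "tangent_nbhd M x U \<equiv> open_submanifold (tangent_manifold M x) U"

lemma tangent_nbhd_simps [simp]:
  "atlas (tangent_nbhd M x U) = {(U, id)}"
  "chart_at (tangent_nbhd M x U) p = (U, id)"
  "metric (tangent_nbhd M x U) p = metric M x"
  "points (tangent_nbhd M x U) = U"
  by (auto simp: open_submanifold_def tangent_manifold_def restrict_chart_def points_def)

lemma chart_inv_id [simp]: "y \<in> U \<Longrightarrow> chart_inv (U, id) y = y"
  unfolding chart_inv_def using inv_into_f_f[of id U y] by simp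

lemma frechet_derivative_transition_id:
  assumes "open U" "p \<in> U"
  shows "frechet_derivative (transition (U, id) (U, id)) (at p) a = a"
  using frechet_derivative_cong[OF assms, of "transition (U, id) (U, id)" "\<lambda>q. q"]
  by (simp add: transition_def)

lemma gram_tangent_nbhd:
  assumes "open U" "y \<in> U"
  shows "gram (tangent_nbhd M x U) (U, id) y v w = metric M x v w"
  using frechet_derivative_transition_id[OF assms] assms(2)
  by (simp add: gram_def tvec_def)

text \<open>The neighbourhood \<open>U\<close> is a Riemannian manifold with constant Gram matrix in its only chart. The
  general formula for the Hessian therefore applies to it, with vanishing Christoffel form.\<close>

lemma riemannian_tangent_nbhd:
  fixes M :: "('m::{t2_space, second_countable_topology}, 'e::euclidean_space) riem"
  assumes M: "riemannian_manifold M" and x: "x \<in> points M" and U: "open U"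
  shows "riemannian_manifold (tangent_nbhd M x U)"
proof -
  have "homeomorphism U U id (chart_inv (U, id))"
    by (rule homeomorphismI) (auto cong: continuous_on_cong)
  then have chart: "is_chart (U, id)"
    using U by (simp add: is_chart_def)
  have "Ck_on k U (transition (U, id) (U, id))" for k
    by (rule Ck_on_cong[OF Ck_on_linear[OF linear_ident] U]) (simp add: transition_def)
  moreover have "Ck_on k U (\<lambda>y. gram (tangent_nbhd M x U) (U, id) y v w)" for k v w
    by (rule Ck_on_cong[OF Ck_on_const U]) (rule gram_tangent_nbhd[OF U, symmetric])
  ultimately show ?thesis
    using chart metric_inner_product[OF M x] by (simp add: riemannian_manifold_def smooth_on_def)
qed

lemma christoffel_tangent_nbhd:
  fixes M :: "('m::{t2_space, second_countable_topology}, 'e::euclidean_space) riem"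
  assumes M: "riemannian_manifold M" and x: "x \<in> points M" and U: "open U" "y \<in> U"
  shows "christoffel (tangent_nbhd M x U) (U, id) y v w = 0"
proof -
  note T = riemannian_tangent_nbhd[OF M x U(1)]
  have c: "(U, id) \<in> atlas (tangent_nbhd M x U)" and y: "y \<in> chart_im (U, id)"
    using U by auto
  have "gram_deriv (tangent_nbhd M x U) (U, id) y h a b = 0" for h a b
    by (rule gram_deriv_eqI[OF T c y has_derivative_const[of "metric M x a b"]])
      (simp add: gram_tangent_nbhd[OF U(1)])
  then show ?thesis
    using koszul[OF T c y] inner_product_bilinear[OF gram_inner_product[OF T c y]]
    by (intro inner_product_eqI[OF gram_inner_product[OF T c y]]) (simp add: bilinear_lzero)
qed

section \<open>Transfer of test functions\<close>

lemma restrict_chart_inv: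
  assumes "is_chart c" "p \<in> chart_dom c" "p \<in> V"
  shows "chart_inv (restrict_chart V c) (chart_map c p) = p"
proof -
  have "inj_on (chart_map c) (chart_dom c)"
    using chart_inv_map[OF assms(1)] by (rule inj_on_inverseI)
  then have "inj_on (chart_map c) (chart_dom c \<inter> V)" by (rule inj_on_subset) blast
  then show ?thesis
    unfolding chart_inv_def restrict_chart_def using inv_into_f_f assms(2,3) by simp
qed

text \<open>The content of the diffeomorphism hypothesis in terms of the charts of \<open>M\<close> itself instead of
  their restrictions to the image. Smoothness of \<open>F\<close> serves to pull test functions back to \<open>U\<close>,
  smoothness of its inverse to push them forward to \<open>M\<close>.\<close>

lemma tangent_diffeomorphismD:
  fixes M :: "('m::{t2_space, second_countable_topology}, 'e::euclidean_space) riem"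
  assumes M: "riemannian_manifold M" and U: "open U"
    and F: "diffeomorphism_onto_image (tangent_nbhd M x U) M F"
  shows "inj_on F U" "open (F ` U)" "F ` U \<subseteq> points M" "continuous_on U F" "continuous_on (F ` U) (inv_into U F)"
    and "\<And>c k. c \<in> atlas M \<Longrightarrow> Ck_on k (U \<inter> F -` chart_dom c) (chart_map c \<circ> F)"
    and "\<And>c k. c \<in> atlas M \<Longrightarrow>
      Ck_on k (chart_map c ` (chart_dom c \<inter> F ` U)) (inv_into U F \<circ> chart_inv c)"
proof -
  let ?N = "open_submanifold M (F ` U)"
  have image: "F ` U \<subseteq> points M" "open (F ` U)" and diff: "diffeomorphism (tangent_nbhd M x U) ?N F"
    using F unfolding diffeomorphism_onto_image_def by auto
  have points_N: "points ?N = F ` U"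
    using image(1) unfolding points_def open_submanifold_def restrict_chart_def by auto
  have bij: "bij_betw F U (F ` U)" and F_smooth: "smooth_map (tangent_nbhd M x U) ?N F"
    and G_smooth: "smooth_map ?N (tangent_nbhd M x U) (inv_into U F)"
    using diff unfolding diffeomorphism_def points_N by simp_all
  show "open (F ` U)" "F ` U \<subseteq> points M" by fact+
  show inj: "inj_on F U" using bij by (rule bij_betw_imp_inj_on)
  show cont: "continuous_on U F" using F_smooth unfolding smooth_map_def by simp
  show "continuous_on (F ` U) (inv_into U F)" using G_smooth unfolding smooth_map_def points_N by simp
  fix c k assume c: "c \<in> atlas M"
  note chart = atlas_chart[OF M c]
  let ?r = "restrict_chart (F ` U) c"
  have r: "?r \<in> atlas ?N" "chart_dom ?r = chart_dom c \<inter> F ` U" "chart_map ?r = chart_map c"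
    using c by (auto simp: open_submanifold_def restrict_chart_def)
  have "Ck_on k (id ` (U \<inter> F -` chart_dom ?r)) (chart_map ?r \<circ> F \<circ> chart_inv (U, id))"
    using F_smooth r(1) unfolding smooth_map_def smooth_on_def by simp
  moreover have "id ` (U \<inter> F -` chart_dom ?r) = U \<inter> F -` chart_dom c" using r(2) by auto
  ultimately have "Ck_on k (U \<inter> F -` chart_dom c) (chart_map c \<circ> F \<circ> chart_inv (U, id))"
    by (simp only: r(3))
  then show "Ck_on k (U \<inter> F -` chart_dom c) (chart_map c \<circ> F)"
    by (rule Ck_on_cong) (auto intro: continuous_open_preimage[OF cont U chart_open(1)[OF chart]])
  have "Ck_on k (chart_map ?r ` (chart_dom ?r \<inter> inv_into U F -` U)) (id \<circ> inv_into U F \<circ> chart_inv ?r)"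
    using G_smooth r(1) unfolding smooth_map_def smooth_on_def by simp
  moreover have "chart_map ?r ` (chart_dom ?r \<inter> inv_into U F -` U) = chart_map c ` (chart_dom c \<inter> F ` U)"
    unfolding r(2,3) by (auto simp: inv_into_f_f[OF inj])
  ultimately have "Ck_on k (chart_map c ` (chart_dom c \<inter> F ` U)) (id \<circ> inv_into U F \<circ> chart_inv ?r)"
    by simp
  then show "Ck_on k (chart_map c ` (chart_dom c \<inter> F ` U)) (inv_into U F \<circ> chart_inv c)"
    by (rule Ck_on_cong[OF _ chart_image_open[OF chart image(2)]])
      (auto simp: restrict_chart_inv[OF chart] chart_inv_map[OF chart])
qed

text \<open>In the chart at \<open>x\<close> write \<open>\<psi> = \<phi> \<circ> E\<close>. The second order chain rule gives
  \<open>D\<^sup>2\<psi>(0) v w = D\<^sup>2\<phi> v w + D\<phi> (D\<^sup>2E(0) v w)\<close>, and \<open>D\<^sup>2E(0) = - \<Gamma>\<close> turns the right-hand side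
  into the Riemannian Hessian.\<close>

lemma jets_agree:
  fixes M :: "('m::{t2_space, second_countable_topology}, 'e::euclidean_space) riem"
  assumes M: "riemannian_manifold M" and x: "x \<in> points M"
    and U: "open U" "0 \<in> U" "U \<subseteq> exp_domain M x"
    and F: "diffeomorphism_onto_image (tangent_nbhd M x U) M (exp_map M x)"
    and N: "open N" "x \<in> N" "C2_on_manifold M N \<phi>"
    and N': "open N'" "0 \<in> N'" "C2_on_manifold (tangent_nbhd M x U) N' \<psi>"
    and eq: "\<And>v. v \<in> U \<Longrightarrow> \<psi> v = \<phi> (exp_map M x v)"
  shows "differential (tangent_nbhd M x U) \<psi> 0 = differential M \<phi> x"
    and "hessian (tangent_nbhd M x U) \<psi> 0 = hessian M \<phi> x"
proof -
  note diffeo = tangent_diffeomorphismD[OF M U(1) F]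
  define c where "c = chart_at M x"
  have cM: "c \<in> atlas M" and xc: "x \<in> chart_dom c"
    using chart_at_atlas[OF M x] chart_at_dom[OF M x] by (auto simp: c_def)
  note chart = atlas_chart[OF M cM]
  let ?E = "chart_map c \<circ> exp_map M x"
  let ?\<phi> = "\<phi> \<circ> chart_inv c"
  let ?W = "U \<inter> exp_map M x -` (chart_dom c \<inter> N)"
  let ?T = "chart_map c ` (chart_dom c \<inter> N)"
  have F0: "exp_map M x 0 = x" using exp_map_zero[OF M x] U by blast
  have W: "open ?W" "0 \<in> ?W"
    using continuous_open_preimage[OF diffeo(4) U(1), of "chart_dom c \<inter> N"] chart_open(1)[OF chart] N(1)
      F0 xc N(2) U(2) by auto
  have T: "open ?T" by (rule chart_image_open[OF chart N(1)])
  have C2_E: "Ck_on 2 ?W ?E"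
    by (rule Ck_on_subset[OF diffeo(6)[OF cM]]) blast
  have C2_\<phi>: "Ck_on 2 ?T ?\<phi>" using N(3) cM unfolding C2_on_manifold_def by blast
  have sub: "?E ` ?W \<subseteq> ?T" by auto
  have E0: "?E 0 = chart_map c x" by (simp add: F0)
  have dom: "exp_map M x u \<in> chart_dom c" if "u \<in> ?W" for u using that by simp
  note order1 = exp_map_second_order(1)[OF M x U c_def refl W dom C2_E]
  note order2 = exp_map_second_order(2)[OF M x U c_def refl W dom C2_E]
  have \<psi>: "(\<psi> \<circ> chart_inv (U, id)) u = ?\<phi> (?E u)" if "u \<in> ?W" for u
    using that by (simp add: eq chart_inv_map[OF chart])
  have d: "frechet_derivative (\<psi> \<circ> chart_inv (U, id)) (at 0) v = frechet_derivative ?\<phi> (at (chart_map c x)) v" for v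
  proof -
    have "frechet_derivative (\<lambda>u. ?\<phi> (?E u)) (at 0) v = frechet_derivative ?\<phi> (at (?E 0)) (frechet_derivative ?E (at 0) v)"
      by (rule derivative_compose[where k = "Suc 0", OF _ _ sub W(2)])
        (use C2_E C2_\<phi> in \<open>simp_all only: numeral_2_eq_2\<close>)
    then show ?thesis
      by (simp only: order1 E0 frechet_derivative_cong[OF W \<psi>])
  qed
  then show "differential (tangent_nbhd M x U) \<psi> 0 = differential M \<phi> x"
    by (intro ext) (simp add: differential_def c_def)
  show "hessian (tangent_nbhd M x U) \<psi> 0 = hessian M \<phi> x"
  proof (intro ext)
    fix v w
    have y: "chart_map c x \<in> chart_im c" using xc by blast
    have "hessian (tangent_nbhd M x U) \<psi> 0 v w =
        frechet_derivative (\<lambda>q. frechet_derivative (\<psi> \<circ> chart_inv (U, id)) (at q) w) (at 0) v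
        - frechet_derivative (\<psi> \<circ> chart_inv (U, id)) (at 0) (christoffel (tangent_nbhd M x U) (U, id) 0 v w)"
      by (rule hessian_in_chart[OF riemannian_tangent_nbhd[OF M x U(1)] _ N']) (use U in auto)
    also have "frechet_derivative (\<psi> \<circ> chart_inv (U, id)) (at 0) (christoffel (tangent_nbhd M x U) (U, id) 0 v w) = 0"
    proof -
      have "\<psi> \<circ> chart_inv (U, id) differentiable at 0"
        using second_order_at[OF riemannian_tangent_nbhd[OF M x U(1)] N'(3), of "(U, id)" 0] U(2) N'(2) by simp
      from linear_0[OF linear_frechet_derivative[OF this]]
      show ?thesis by (simp add: christoffel_tangent_nbhd[OF M x U(1,2)])
    qed
    also have "frechet_derivative (\<lambda>q. frechet_derivative (\<psi> \<circ> chart_inv (U, id)) (at q) w) (at 0) v =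
        frechet_derivative (\<lambda>q. frechet_derivative (\<lambda>u. ?\<phi> (?E u)) (at q) w) (at 0) v"
      by (simp only: second_derivative_cong[OF W \<psi>])
    also have "\<dots> = frechet_derivative (\<lambda>q. frechet_derivative ?\<phi> (at q) (frechet_derivative ?E (at 0) w)) (at (?E 0))
        (frechet_derivative ?E (at 0) v)
      + frechet_derivative ?\<phi> (at (?E 0)) (frechet_derivative (\<lambda>p. frechet_derivative ?E (at p) w) (at 0) v)"
      by (rule second_derivative_compose[OF C2_\<phi> C2_E W(1) T sub W(2)])
    also have "\<dots> = frechet_derivative (\<lambda>q. frechet_derivative ?\<phi> (at q) w) (at (chart_map c x)) v
        + frechet_derivative ?\<phi> (at (chart_map c x)) (- christoffel M c (chart_map c x) v w)"
      by (simp only: order1 order2 E0 christoffel_commute[OF M cM y, of w v])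
    also have "\<dots> - 0 = frechet_derivative (\<lambda>q. frechet_derivative ?\<phi> (at q) w) (at (chart_map c x)) v
        - frechet_derivative ?\<phi> (at (chart_map c x)) (christoffel M c (chart_map c x) v w)"
      using linear_neg[OF linear_frechet_derivative[OF second_order_at[OF M N(3) cM xc N(2)]]] by simp
    also have "\<dots> = hessian M \<phi> x v w"
      by (rule hessian_in_chart[OF M x N c_def refl, symmetric])
    finally show "hessian (tangent_nbhd M x U) \<psi> 0 v w = hessian M \<phi> x v w" .
  qed
qed

lemma eventually_at_within_open_iff_nhds:
  assumes "open S" "x \<in> S" "P x"
  shows "(\<forall>\<^sub>F y in at x within S. P y) \<longleftrightarrow> (\<forall>\<^sub>F y in nhds x. P y)"
proof -
  have "(\<forall>\<^sub>F y in nhds x. P y)" if "\<forall>\<^sub>F y in nhds x. y \<noteq> x \<longrightarrow> y \<in> S \<longrightarrow> P y"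
    using that eventually_nhds_in_open[OF assms(1,2)] by eventually_elim (use assms(3) in blast)
  then show ?thesis
    unfolding eventually_at_filter by (auto elim: eventually_mono)
qed

lemma eventually_nhds_homeomorphism:
  fixes F :: "'a::t2_space \<Rightarrow> 'b::t2_space"
  assumes "open U" "a \<in> U" "inj_on F U" "open (F ` U)"
    and F: "continuous_on U F" and G: "continuous_on (F ` U) (inv_into U F)"
  shows "(\<forall>\<^sub>F y in nhds (F a). P y) \<longleftrightarrow> (\<forall>\<^sub>F v in nhds a. P (F v))"
proof
  have "(F \<longlongrightarrow> F a) (nhds a)"
    using F assms(1,2) tendsto_at_iff_tendsto_nhds
    unfolding continuous_on_eq_continuous_at[OF assms(1)] isCont_def by blast
  then show "\<forall>\<^sub>F y in nhds (F a). P y \<Longrightarrow> \<forall>\<^sub>F v in nhds a. P (F v)"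
    by (rule eventually_compose_filterlim[rotated])
next
  have G0: "inv_into U F (F a) = a" by (rule inv_into_f_f[OF assms(3,2)])
  have "F a \<in> F ` U" using assms(2) by blast
  moreover have "(inv_into U F \<longlongrightarrow> inv_into U F (F a)) (nhds (F a))"
    using G \<open>F a \<in> F ` U\<close> tendsto_at_iff_tendsto_nhds
    unfolding continuous_on_eq_continuous_at[OF assms(4)] isCont_def by blast
  then have lim: "(inv_into U F \<longlongrightarrow> a) (nhds (F a))" by (simp only: G0)
  assume "\<forall>\<^sub>F v in nhds a. P (F v)"
  from eventually_compose_filterlim[OF this lim] eventually_nhds_in_open[OF assms(4) \<open>F a \<in> F ` U\<close>]
  show "\<forall>\<^sub>F y in nhds (F a). P y"
    by eventually_elim (simp add: f_inv_into_f)
qed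

theorem corollary2p3:
  fixes M :: "('m::{t2_space, second_countable_topology}, 'e::euclidean_space) riem"
    and f :: "'m \<Rightarrow> ereal"
    and x :: 'm
    and \<zeta> :: "'e \<Rightarrow> real"
    and A :: "'e \<Rightarrow> 'e \<Rightarrow> real"
    and U :: "'e set"
  assumes "riemannian_manifold M"
    and "\<forall>y\<in>points M. f y \<noteq> -\<infinity>"
    and "lower_semicontinuous_on (points M) f"
    and "x \<in> points M"
    and "linear \<zeta>"
    and "bilinear A" and "\<forall>v w. A v w = A w v"
    and "open U" and "0 \<in> U" and "U \<subseteq> exp_domain M x"
    and "diffeomorphism_onto_image (open_submanifold (tangent_manifold M x) U) M (exp_map M x)"
  shows "(\<zeta>, A) \<in> subjet2 M f x \<longleftrightarrow>
         (\<zeta>, A) \<in> subjet2 (open_submanifold (tangent_manifold M x) U) (f \<circ> exp_map M x) 0"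
proof -
  note M = assms(1) and x = assms(4) and U = assms(8,9,10) and F = assms(11)
  note diffeo = tangent_diffeomorphismD[OF M U(1) F]
  let ?F = "exp_map M x" and ?G = "inv_into U (exp_map M x)"
  have F0: "?F 0 = x" using exp_map_zero[OF M x] U by blast
  have minimum: "(\<forall>\<^sub>F y in at x within points M. f x - ereal (\<phi> x) \<le> f y - ereal (\<phi> y)) \<longleftrightarrow>
      (\<forall>\<^sub>F v in at 0 within U. (f \<circ> ?F) 0 - ereal (\<psi> 0) \<le> (f \<circ> ?F) v - ereal (\<psi> v))"
    if eq: "\<And>v. v \<in> U \<Longrightarrow> \<psi> v = \<phi> (?F v)" for \<phi> \<psi>
  proof -
    let ?P = "\<lambda>y. f x - ereal (\<phi> x) \<le> f y - ereal (\<phi> y)"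
    have "(\<forall>\<^sub>F y in at x within points M. ?P y) \<longleftrightarrow> (\<forall>\<^sub>F y in nhds x. ?P y)"
      by (rule eventually_at_within_open_iff_nhds[OF open_points[OF M] x]) simp
    also have "\<dots> \<longleftrightarrow> (\<forall>\<^sub>F v in nhds 0. ?P (?F v))"
      using eventually_nhds_homeomorphism[OF U(1,2) diffeo(1,2,4,5), of ?P] by (simp only: F0)
    also have "\<dots> \<longleftrightarrow> (\<forall>\<^sub>F v in at 0 within U. ?P (?F v))"
      by (rule eventually_at_within_open_iff_nhds[OF U(1,2), symmetric]) (simp add: F0)
    also have "\<dots> \<longleftrightarrow> (\<forall>\<^sub>F v in at 0 within U. (f \<circ> ?F) 0 - ereal (\<psi> 0) \<le> (f \<circ> ?F) v - ereal (\<psi> v))"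
      unfolding eventually_at_filter using eq U(2) F0
      by (intro eventually_cong refl always_eventually) auto
    finally show ?thesis .
  qed
  show ?thesis
  proof
    assume "(\<zeta>, A) \<in> subjet2 M f x"
    then obtain \<phi> N where jet: "\<zeta> = differential M \<phi> x" "A = hessian M \<phi> x"
      and N: "open N" "x \<in> N" "C2_on_manifold M N \<phi>"
      and min: "\<forall>\<^sub>F y in at x within points M. f x - ereal (\<phi> x) \<le> f y - ereal (\<phi> y)"
      unfolding subjet2_def by blast
    define c where "c = chart_at M x"
    have cM: "c \<in> atlas M" and xc: "x \<in> chart_dom c"
      using chart_at_atlas[OF M x] chart_at_dom[OF M x] by (auto simp: c_def)
    note chart = atlas_chart[OF M cM]
    \<comment> \<open>Staying inside one chart domain, \<open>\<phi> \<circ> exp\<^sub>x\<close> factors through that chart.\<close>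
    let ?N' = "U \<inter> ?F -` (chart_dom c \<inter> N)"
    have N': "open ?N'" "0 \<in> ?N'"
      using continuous_open_preimage[OF diffeo(4) U(1), of "chart_dom c \<inter> N"] chart_open(1)[OF chart] N(1)
        F0 xc N(2) U(2) by auto
    have "Ck_on 2 ?N' (\<lambda>v. (\<phi> \<circ> chart_inv c) ((chart_map c \<circ> ?F) v))"
    proof (rule Ck_on_compose[OF N'(1) chart_image_open[OF chart N(1)]])
      show "Ck_on 2 (chart_map c ` (chart_dom c \<inter> N)) (\<phi> \<circ> chart_inv c)"
        using N(3) cM unfolding C2_on_manifold_def by blast
      show "Ck_on 2 ?N' (chart_map c \<circ> ?F)"
        by (rule Ck_on_subset[OF diffeo(6)[OF cM]]) blast
    qed auto
    then have "Ck_on 2 ?N' ((\<phi> \<circ> ?F) \<circ> chart_inv (U, id))"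
      by (rule Ck_on_cong[OF _ N'(1)]) (simp add: chart_inv_map[OF chart])
    then have C2: "C2_on_manifold (tangent_nbhd M x U) ?N' (\<phi> \<circ> ?F)"
      by (simp add: C2_on_manifold_def Int_left_absorb)
    have "\<zeta> = differential (tangent_nbhd M x U) (\<phi> \<circ> ?F) 0" "A = hessian (tangent_nbhd M x U) (\<phi> \<circ> ?F) 0"
      unfolding jet using jets_agree[OF M x U F N N' C2] by simp_all
    moreover have "\<forall>\<^sub>F v in at 0 within U. (f \<circ> ?F) 0 - ereal ((\<phi> \<circ> ?F) 0) \<le> (f \<circ> ?F) v - ereal ((\<phi> \<circ> ?F) v)"
      using minimum[of "\<phi> \<circ> ?F" \<phi>] min by simp
    ultimately show "(\<zeta>, A) \<in> subjet2 (tangent_nbhd M x U) (f \<circ> ?F) 0"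
      unfolding subjet2_def using N' C2
      by (intro CollectI exI[of _ "\<phi> \<circ> ?F"]) (auto intro!: exI[of _ ?N'])
  next
    assume "(\<zeta>, A) \<in> subjet2 (tangent_nbhd M x U) (f \<circ> ?F) 0"
    then obtain \<psi> N' where jet: "\<zeta> = differential (tangent_nbhd M x U) \<psi> 0" "A = hessian (tangent_nbhd M x U) \<psi> 0"
      and N': "open N'" "0 \<in> N'" "C2_on_manifold (tangent_nbhd M x U) N' \<psi>" and N'U: "N' \<subseteq> U"
      and min: "\<forall>\<^sub>F v in at 0 within U. (f \<circ> ?F) 0 - ereal (\<psi> 0) \<le> (f \<circ> ?F) v - ereal (\<psi> v)"
      unfolding subjet2_def by auto
    let ?\<phi> = "\<psi> \<circ> ?G"
    let ?N = "?F ` U \<inter> ?G -` N'"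
    have eq: "\<psi> v = ?\<phi> (?F v)" if "v \<in> U" for v
      using that by (simp add: inv_into_f_f[OF diffeo(1)])
    have N: "open ?N" "x \<in> ?N" "?N \<subseteq> points M"
    proof -
      show "open ?N" by (rule continuous_open_preimage[OF diffeo(5,2) N'(1)])
      have "?F 0 \<in> ?N" using U(2) N'(2) by (simp add: inv_into_f_f[OF diffeo(1)])
      then show "x \<in> ?N" by (simp only: F0)
    qed (use diffeo(3) in blast)
    have "id ` (U \<inter> N') = N'" using N'U by auto
    then have C2_\<psi>: "Ck_on 2 N' (\<psi> \<circ> chart_inv (U, id))"
      using N'(3) by (simp add: C2_on_manifold_def)
    have C2: "C2_on_manifold M ?N ?\<phi>"
      unfolding C2_on_manifold_def
    proof
      fix c assume c: "c \<in> atlas M"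
      note chart = atlas_chart[OF M c]
      let ?S = "chart_map c ` (chart_dom c \<inter> ?N)"
      note S = chart_image_open[OF chart N(1)]
      have maps: "(?G \<circ> chart_inv c) ` ?S \<subseteq> N'" using chart_inv_map[OF chart] by auto
      have "Ck_on 2 ?S (\<lambda>y. (\<psi> \<circ> chart_inv (U, id)) ((?G \<circ> chart_inv c) y))"
        by (rule Ck_on_compose[OF S N'(1) maps C2_\<psi> Ck_on_subset[OF diffeo(7)[OF c]]]) blast
      then show "Ck_on 2 ?S (?\<phi> \<circ> chart_inv c)"
      proof (rule Ck_on_cong[OF _ S])
        fix y assume "y \<in> ?S"
        then have "(?G \<circ> chart_inv c) y \<in> U" using maps N'U by blast
        then show "(\<psi> \<circ> chart_inv (U, id)) ((?G \<circ> chart_inv c) y) = (?\<phi> \<circ> chart_inv c) y" by simp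
      qed
    qed
    have "\<zeta> = differential M ?\<phi> x"
      unfolding jet by (rule jets_agree(1)[OF M x U F N(1,2) C2 N' eq])
    moreover have "A = hessian M ?\<phi> x"
      unfolding jet by (rule jets_agree(2)[OF M x U F N(1,2) C2 N' eq])
    moreover have "\<forall>\<^sub>F y in at x within points M. f x - ereal (?\<phi> x) \<le> f y - ereal (?\<phi> y)"
      using minimum[of \<psi> ?\<phi>, OF eq] min by blast
    ultimately show "(\<zeta>, A) \<in> subjet2 M f x"
      unfolding subjet2_def using N C2 by (intro CollectI exI[of _ ?\<phi>]) blast
  qed
qed

end
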